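(* Let $m,n$ be relatively prime positive integers. The map $B$ sending an affine permutation $w\in\widetilde{\mathfrak{S}}_n$ with $w^{-1}\in\mathcal{S}_m^n$ to the word $B(w)={\sf p}_1\cdots{\sf p}_n$, where $${\sf p}_i=\big|\{j\in\mathbb{N}: j>i,\ w(j)<w(i),\ w(i)-w(j)<m\}\big|,$$ is a bijection from $\{w\in\widetilde{\mathfrak{S}}_n: w^{-1}\in\mathcal{S}_m^n\}$ to the set $\mathcal{PW}_m^n$ of $(m,n)$-parking words.
   Context: The affine symmetric group $\widetilde{\mathfrak{S}}_n$ is the group of bijections $w:\mathbb{Z}\to\mathbb{Z}$ with $w(i+n)=w(i)+n$ for all $i$ and $\sum_{i=1}^n w(i)=\binom{n+1}{2}$. The Sommers region $\mathcal{S}_m^n$ is the region bounded by the $n$ affine hyperplanes of height $m$ in the affine $\widetilde{\mathfrak{S}}_n$ hyperplane arrangement; writing $w^{-1}\in\mathcal{S}_m^n$ means $w^{-1}$ labels an alcove inside it, which (by a known characterization) holds if and only if $w(i)-w(j)\ne m$ for all integers $i<j$. $[m]=\{0,\ldots,m-1\}$ and $\mathcal{PW}_m^n$ is the set of ${\sf p}={\sf p}_1\cdots{\sf p}_n\in[m]^n$ with $|\{j:{\sf p}_j<i\}|\ge in/m$ for $1\le i\le m$. *)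

theory Defs
  imports Complex_Main "HOL-Library.FuncSet"
begin

definition affine_sym_group :: "nat \<Rightarrow> (int \<Rightarrow> int) set" where
  "affine_sym_group n =
     {w. bij w \<and> (\<forall>i. w (i + int n) = w i + int n) \<and>
         (\<Sum>i\<in>{1..int n}. w i) = int ((n + 1) choose 2)}"

text \<open>
  The arrangement lives in the hyperplane of vectors of coordinate sum \<open>0\<close> in \<open>n\<close>-dimensional
  real space. Vectors are extensional functions on the index set \<open>{1..n}\<close>.
\<close>

definition coord_space :: "nat \<Rightarrow> (int \<Rightarrow> real) set" where
  "coord_space n = {x \<in> {1..int n} \<rightarrow>\<^sub>E UNIV. (\<Sum>i\<in>{1..int n}. x i) = 0}"

text \<open>
  For \<open>1 \<le> i < j \<le> n\<close> and an integer \<open>k\<close>, the hyperplane \<open>x i - x j = k\<close> of the affine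
  arrangement is the zero set of \<open>aff_root i j k\<close>. The affine root \<open>x i - x j - k\<close> has height
  \<open>(j - i) - k n\<close>, since the root \<open>x i - x j\<close> has height \<open>j - i\<close> and the null root has height
  \<open>n\<close>; the hyperplane gets the height of the positive one of its two opposite affine roots.
\<close>

definition aff_root :: "int \<Rightarrow> int \<Rightarrow> int \<Rightarrow> (int \<Rightarrow> real) \<Rightarrow> real" where
  "aff_root i j k x = x i - x j - of_int k"

definition hyperplane_height :: "nat \<Rightarrow> int \<Rightarrow> int \<Rightarrow> int \<Rightarrow> int" where
  "hyperplane_height n i j k = \<bar>j - i - k * int n\<bar>"

definition fundamental_alcove :: "nat \<Rightarrow> (int \<Rightarrow> real) set" where
  "fundamental_alcove n =
     {x \<in> coord_space n. (\<forall>i\<in>{1..<int n}. x i > x (i + 1)) \<and> x (int n) > x 1 - 1}"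

text \<open>
  The region bounded by the hyperplanes of height \<open>m\<close>: the closed region, containing the
  fundamental alcove, of the points not separated from it by any hyperplane of height \<open>m\<close>.
\<close>

definition sommers_region :: "nat \<Rightarrow> nat \<Rightarrow> (int \<Rightarrow> real) set" where
  "sommers_region m n =
     {x \<in> coord_space n. \<forall>i j k. 1 \<le> i \<and> i < j \<and> j \<le> int n \<and> hyperplane_height n i j k = int m \<longrightarrow>
        (\<forall>y \<in> fundamental_alcove n. aff_root i j k x * aff_root i j k y \<ge> 0)}"

text \<open>
  Coordinates are extended to all integer indices by \<open>x (i + n) = x i - 1\<close>, so that the
  fundamental alcove consists of the points with strictly decreasing extended coordinates.
  An affine permutation \<open>u\<close> acts on the right by permuting the extended coordinates, and
  labels the image of the fundamental alcove under this action; for the usual left action,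
  sending \<open>x\<close> to the point with coordinates \<open>x (u\<^sup>-\<^sup>1 i)\<close>, this is the image under the inverse of
  \<open>u\<close>. With this labelling the condition \<open>w\<^sup>-\<^sup>1 \<in> \<S>\<close> below is the usual condition
  \<open>w i - w j \<noteq> m\<close> for all \<open>i < j\<close>; see \<open>inv_in_sommers_perms_iff\<close>.
\<close>

definition ext_coord :: "nat \<Rightarrow> (int \<Rightarrow> real) \<Rightarrow> int \<Rightarrow> real" where
  "ext_coord n x a = x ((a - 1) mod int n + 1) - of_int ((a - 1) div int n)"

definition permute_coords :: "nat \<Rightarrow> (int \<Rightarrow> int) \<Rightarrow> (int \<Rightarrow> real) \<Rightarrow> (int \<Rightarrow> real)" where
  "permute_coords n u x = (\<lambda>i\<in>{1..int n}. ext_coord n x (u i))"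

definition alcove :: "nat \<Rightarrow> (int \<Rightarrow> int) \<Rightarrow> (int \<Rightarrow> real) set" where
  "alcove n u = permute_coords n u ` fundamental_alcove n"

definition sommers_perms :: "nat \<Rightarrow> nat \<Rightarrow> (int \<Rightarrow> int) set" where
  "sommers_perms m n = {u \<in> affine_sym_group n. alcove n u \<subseteq> sommers_region m n}"

definition parking_words :: "nat \<Rightarrow> nat \<Rightarrow> nat list set" where
  "parking_words m n =
     {p. length p = n \<and> set p \<subseteq> {0..<m} \<and>
         (\<forall>i\<in>{1..m}. real (card {j. j < n \<and> p ! j < i}) \<ge> real (i * n) / real m)}"

definition B_map :: "nat \<Rightarrow> nat \<Rightarrow> (int \<Rightarrow> int) \<Rightarrow> nat list" where
  "B_map m n w =
     map (\<lambda>i. card {j::nat. j > i \<and> w (int j) < w (int i) \<and> w (int i) - w (int j) < int m}) [1..<n+1]"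


lemma ext_coord_add:
  assumes "n > 0"
  shows "ext_coord n x (a + t * int n) = ext_coord n x a - of_int t"
proof -
  have e: "a + t * int n - 1 = (a - 1) + t * int n" by simp
  show ?thesis unfolding ext_coord_def e using assms by simp
qed

lemma mod_plus_one_in:
  assumes "n > 0"
  shows "z mod int n + 1 \<in> {1..int n}"
proof -
  have "0 \<le> z mod int n" "z mod int n < int n" using assms by simp_all
  then show ?thesis by simp
qed

lemma ext_coord_id:
  assumes "a \<in> {1..int n}"
  shows "ext_coord n x a = x a"
  using assms by (simp add: ext_coord_def)

lemma affine_shift:
  assumes "u \<in> affine_sym_group n"
  shows "u (a + t * int n) = u a + t * int n"
proof -
  have s: "u (i + int n) = u i + int n" for i
    using assms by (simp add: affine_sym_group_def)
  have p: "u (a + int t * int n) = u a + int t * int n" for a t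
  proof (induction t)
    case (Suc t)
    have "u (a + int (Suc t) * int n) = u ((a + int t * int n) + int n)"
      by (simp add: algebra_simps)
    also have "\<dots> = u (a + int t * int n) + int n" by (rule s)
    finally show ?case using Suc by (simp add: algebra_simps)
  qed simp
  show ?thesis
  proof (cases "t \<ge> 0")
    case True
    then show ?thesis using p[of a "nat t"] by simp
  next
    case False
    then show ?thesis using p[of "a + t * int n" "nat (-t)"] by simp
  qed
qed

lemma ext_coord_decreasing:
  assumes n: "n > 0" and x: "x \<in> fundamental_alcove n" and ab: "a < b"
  shows "ext_coord n x b < ext_coord n x a"
proof -
  have step: "ext_coord n x (c + 1) < ext_coord n x c" for c
  proof -
    define r where "r = (c - 1) mod int n + 1"
    define q where "q = (c - 1) div int n"
    have c: "c = r + q * int n" by (simp add: r_def q_def)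
    have r: "r \<in> {1..int n}"
      unfolding r_def by (rule mod_plus_one_in[OF n])
    have "ext_coord n x (r + 1) < ext_coord n x r"
    proof (cases "r = int n")
      case True
      have "ext_coord n x (1 + 1 * int n) = ext_coord n x 1 - of_int 1"
        using n by (rule ext_coord_add)
      then have "ext_coord n x (r + 1) = x 1 - 1"
        using True n by (simp add: ext_coord_id add.commute)
      then show ?thesis using x r True by (simp add: ext_coord_id fundamental_alcove_def)
    next
      case False
      then show ?thesis using x r by (simp add: ext_coord_id fundamental_alcove_def)
    qed
    moreover have "ext_coord n x (c + 1) = ext_coord n x (r + 1) - q"
    proof -
      have e: "c + 1 = (r + 1) + q * int n" using c by simp
      show ?thesis unfolding e by (rule ext_coord_add[OF n])
    qed
    moreover have "ext_coord n x c = ext_coord n x r - q"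
      unfolding c by (rule ext_coord_add[OF n])
    ultimately show ?thesis by linarith
  qed
  show ?thesis
    using ab
  proof (induction b rule: int_gr_induct)
    case base show ?case by (rule step)
  next
    case (step i) then show ?case using \<open>\<And>c. ext_coord n x (c + 1) < ext_coord n x c\<close>[of i] by simp
  qed
qed

lemma ext_coord_less_iff:
  assumes "n > 0" and "x \<in> fundamental_alcove n"
  shows "ext_coord n x a < ext_coord n x b \<longleftrightarrow> b < a"
  using ext_coord_decreasing[OF assms] by (metis linorder_less_linear order_less_asym)

lemma fundamental_alcove_nonempty:
  assumes n: "n > 0"
  shows "fundamental_alcove n \<noteq> {}"
proof -
  define s where "s = (\<Sum>i\<in>{1..int n}. real_of_int i) / real n"
  define x :: "int \<Rightarrow> real" where "x = (\<lambda>i\<in>{1..int n}. (s - real_of_int i) / real n)"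
  have "(\<Sum>i\<in>{1..int n}. x i) = (\<Sum>i\<in>{1..int n}. (s - real_of_int i)) / real n"
    by (simp add: x_def sum_divide_distrib)
  also have "\<dots> = 0" using n by (simp add: sum_subtractf s_def)
  finally have "x \<in> coord_space n" by (simp add: coord_space_def x_def)
  then have "x \<in> fundamental_alcove n"
    using n by (auto simp: fundamental_alcove_def x_def field_simps)
  then show ?thesis by blast
qed

lemma affine_window:
  fixes u n
  defines "r \<equiv> \<lambda>i. (u i - 1) mod int n + 1" and "q \<equiv> \<lambda>i. (u i - 1) div int n"
  assumes n: "n > 0" and u: "u \<in> affine_sym_group n"
  shows "bij_betw r {1..int n} {1..int n}" and "(\<Sum>i\<in>{1..int n}. q i) = 0"
    and "(\<Sum>i\<in>{1..int n}. i) = int ((n + 1) choose 2)"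
proof -
  let ?I = "{1..int n}"
  have u_eq: "u i = r i + q i * int n" for i by (simp add: r_def q_def)
  have inj: "inj_on r ?I"
  proof (rule inj_onI)
    fix i j assume ij: "i \<in> ?I" "j \<in> ?I" "r i = r j"
    have "u i = u j + (q i - q j) * int n" using ij u_eq[of i] u_eq[of j] by (simp add: algebra_simps)
    also have "\<dots> = u (j + (q i - q j) * int n)" using affine_shift[OF u] by simp
    finally have e: "i = j + (q i - q j) * int n"
      using u by (auto simp: affine_sym_group_def dest: bij_is_inj injD)
    then have "(i - 1) mod int n = (j - 1) mod int n"
      by (metis add_diff_eq add.commute mod_mult_self1)
    then show "i = j" using ij by simp
  qed
  have sub: "r ` ?I \<subseteq> ?I" using mod_plus_one_in[OF n] by (auto simp: r_def simp del: atLeastAtMost_iff)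
  show bij: "bij_betw r ?I ?I"
    using inj sub by (simp add: bij_betw_def endo_inj_surj)
  show sI: "(\<Sum>i\<in>?I. i) = int ((n + 1) choose 2)"
  proof -
    have "(\<Sum>i\<in>?I. i) = (\<Sum>i\<in>{1..n}. int i)"
      by (rule sum.reindex_bij_witness[of _ int nat]) auto
    also have "\<dots> = int (\<Sum>{1..n})" by simp
    also have "(\<Sum>{1..n}) = (n + 1) choose 2"
      using gauss_sum_from_Suc_0[of n, where 'a = nat] by (simp add: choose_two algebra_simps)
    finally show ?thesis .
  qed
  have "(\<Sum>i\<in>?I. u i) = (\<Sum>i\<in>?I. i)" using u sI by (simp add: affine_sym_group_def)
  moreover have "(\<Sum>i\<in>?I. u i) = (\<Sum>i\<in>?I. r i) + (\<Sum>i\<in>?I. q i) * int n"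
    by (simp add: u_eq sum.distrib sum_distrib_right)
  moreover have "(\<Sum>i\<in>?I. r i) = (\<Sum>i\<in>?I. i)"
    using sum.reindex_bij_betw[OF bij, of "\<lambda>i. i"] by simp
  ultimately show "(\<Sum>i\<in>?I. q i) = 0" using n by simp
qed

lemma permute_coords_in_coord_space:
  assumes n: "n > 0" and u: "u \<in> affine_sym_group n" and x: "x \<in> coord_space n"
  shows "permute_coords n u x \<in> coord_space n"
proof -
  let ?I = "{1..int n}"
  define r where "r i = (u i - 1) mod int n + 1" for i
  define q where "q i = (u i - 1) div int n" for i
  have bij: "bij_betw r ?I ?I" and q0: "(\<Sum>i\<in>?I. q i) = 0"
    using affine_window(1,2)[OF n u] by (simp_all add: r_def[abs_def] q_def[abs_def])
  have "(\<Sum>i\<in>?I. permute_coords n u x i) = (\<Sum>i\<in>?I. x (r i)) - of_int (\<Sum>i\<in>?I. q i)"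
    by (simp add: permute_coords_def ext_coord_def r_def q_def sum_subtractf)
  also have "(\<Sum>i\<in>?I. x (r i)) = (\<Sum>i\<in>?I. x i)" by (rule sum.reindex_bij_betw[OF bij])
  finally show ?thesis using x q0 by (simp add: coord_space_def permute_coords_def)
qed

lemma inv_affine:
  assumes n: "n > 0" and w: "w \<in> affine_sym_group n"
  shows "inv w \<in> affine_sym_group n"
proof -
  let ?I = "{1..int n}"
  define r where "r i = (w i - 1) mod int n + 1" for i
  define q where "q i = (w i - 1) div int n" for i
  have bij: "bij_betw r ?I ?I" and q0: "(\<Sum>i\<in>?I. q i) = 0"
    using affine_window(1,2)[OF n w] by (simp_all add: r_def[abs_def] q_def[abs_def])
  have b: "bij w" using w by (simp add: affine_sym_group_def)
  have wi: "w (inv w a) = a" and iw: "inv w (w a) = a" for a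
    using b by (simp_all add: bij_is_surj bij_is_inj surj_f_inv_f inv_f_f)
  have sh: "inv w (a + t * int n) = inv w a + t * int n" for a t
    using affine_shift[OF w, of "inv w a" t] iw[of "inv w a + t * int n"] by (simp add: wi)
  have inv_r: "inv w (r i) = i - q i * int n" for i
  proof -
    have "w i = r i + q i * int n" by (simp add: r_def q_def)
    then show ?thesis using sh[of "r i" "q i"] iw[of i] by simp
  qed
  have "(\<Sum>i\<in>?I. inv w i) = (\<Sum>i\<in>?I. inv w (r i))"
    by (rule sum.reindex_bij_betw[OF bij, symmetric])
  also have "\<dots> = (\<Sum>i\<in>?I. i) - (\<Sum>i\<in>?I. q i) * int n"
    by (simp add: inv_r sum_subtractf sum_distrib_right)
  also have "\<dots> = int ((n + 1) choose 2)" using q0 affine_window(3)[OF n w] by simp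
  finally show ?thesis
    using b sh[of _ 1] by (simp add: affine_sym_group_def bij_imp_bij_inv)
qed

lemma sommers_perms_iff:
  assumes n: "n > 0" and m: "m > 0" and u: "u \<in> affine_sym_group n"
  shows "u \<in> sommers_perms m n \<longleftrightarrow> (\<forall>a. u a < u (a + int m))"
proof -
  have root_alc: "aff_root i j k y = ext_coord n y i - ext_coord n y (j - k * int n)"
    if "i \<in> {1..int n}" "j \<in> {1..int n}" for i j k y
    using ext_coord_add[OF n, of y j "-k"] that by (simp add: aff_root_def ext_coord_id)
  have root_perm: "aff_root i j k (permute_coords n u x) =
      ext_coord n x (u i) - ext_coord n x (u (j - k * int n))"
    if "i \<in> {1..int n}" "j \<in> {1..int n}" for i j k x
    using ext_coord_add[OF n, of x "u j" "-k"] affine_shift[OF u, of j "-k"] that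
    by (simp add: aff_root_def permute_coords_def)
  have sgn: "aff_root i j k (permute_coords n u x) * aff_root i j k y \<ge> 0 \<longleftrightarrow>
      (i < j - k * int n \<longleftrightarrow> u i < u (j - k * int n))"
    if "i \<in> {1..int n}" "j \<in> {1..int n}" "hyperplane_height n i j k = int m"
      "x \<in> fundamental_alcove n" "y \<in> fundamental_alcove n" for i j k x y
  proof -
    have ne: "i \<noteq> j - k * int n" using that(3) m by (auto simp: hyperplane_height_def)
    then have ne': "u i \<noteq> u (j - k * int n)"
      using u by (auto simp: affine_sym_group_def dest: bij_is_inj injD)
    show ?thesis
      unfolding root_perm[OF that(1,2)] root_alc[OF that(1,2), of k y] zero_le_mult_iff
      using ne ne' ext_coord_less_iff[OF n that(4), of "u i" "u (j - k * int n)"]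
        ext_coord_less_iff[OF n that(4), of "u (j - k * int n)" "u i"]
        ext_coord_less_iff[OF n that(5), of i "j - k * int n"]
        ext_coord_less_iff[OF n that(5), of "j - k * int n" i] by linarith
  qed
  have "u \<in> sommers_perms m n \<longleftrightarrow>
      (\<forall>i j k. 1 \<le> i \<and> i < j \<and> j \<le> int n \<and> hyperplane_height n i j k = int m \<longrightarrow>
        (i < j - k * int n \<longleftrightarrow> u i < u (j - k * int n)))" (is "_ \<longleftrightarrow> ?R")
  proof
    assume L: "u \<in> sommers_perms m n"
    obtain x where x: "x \<in> fundamental_alcove n" using fundamental_alcove_nonempty[OF n] by blast
    then have "permute_coords n u x \<in> sommers_region m n"
      using L by (auto simp: sommers_perms_def alcove_def)
    then show ?R using sgn x unfolding sommers_region_def by fastforce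
  next
    assume R: ?R
    have "permute_coords n u x \<in> sommers_region m n" if x: "x \<in> fundamental_alcove n" for x
      using R sgn x permute_coords_in_coord_space[OF n u, of x]
      unfolding sommers_region_def by (fastforce simp: fundamental_alcove_def)
    then show "u \<in> sommers_perms m n" using u by (auto simp: sommers_perms_def alcove_def)
  qed
  also have "?R \<longleftrightarrow> (\<forall>a. u a < u (a + int m))"
  proof
    assume R: ?R
    show "\<forall>a. u a < u (a + int m)"
    proof
      fix a
      define i where "i = (a - 1) mod int n + 1"
      define s where "s = (a - 1) div int n"
      define j where "j = (a + int m - 1) mod int n + 1"
      define t where "t = (a + int m - 1) div int n"
      have a: "a = i + s * int n" by (simp add: i_def s_def)
      have am: "a + int m = j + t * int n"
        using mod_div_mult_eq[of "a + int m - 1" "int n"] by (simp add: j_def t_def)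
      have ij: "i \<in> {1..int n}" "j \<in> {1..int n}"
        unfolding i_def j_def by (rule mod_plus_one_in[OF n])+
      consider "i < j" | "j < i" | "i = j" by linarith
      then show "u a < u (a + int m)"
      proof cases
        case 1
        have e: "j - (s - t) * int n = i + int m" using a am by (simp add: algebra_simps)
        then have "hyperplane_height n i j (s - t) = int m" by (simp add: hyperplane_height_def)
        then have "u i < u (i + int m)" using R 1 ij e m by fastforce
        moreover have "u a = u i + s * int n" using affine_shift[OF u] a by simp
        moreover have "u (a + int m) = u (i + int m) + s * int n"
          using affine_shift[OF u, of "i + int m" s] a by (simp add: algebra_simps)
        ultimately show ?thesis by simp
      next
        case 2
        have e: "i - (t - s) * int n = j - int m" using a am by (simp add: algebra_simps)
        then have "hyperplane_height n j i (t - s) = int m" by (simp add: hyperplane_height_def)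
        then have "\<not> u j < u (j - int m)" using R 2 ij e m by fastforce
        moreover have "u j \<noteq> u (j - int m)"
          using u m by (auto simp: affine_sym_group_def dest!: bij_is_inj injD)
        moreover have "u (a + int m) = u j + t * int n" using affine_shift[OF u] am by simp
        moreover have "u a = u (j - int m) + t * int n"
        proof -
          have "a = (j - int m) + t * int n" using am by simp
          then show ?thesis using affine_shift[OF u] by simp
        qed
        ultimately show ?thesis by simp
      next
        case 3
        then have "int m = (t - s) * int n" using a am by (simp add: algebra_simps)
        then show ?thesis using affine_shift[OF u, of a "t - s"] m by simp
      qed
    qed
  next
    assume S: "\<forall>a. u a < u (a + int m)"
    show ?R
    proof (intro allI impI)
      fix i j k assume A: "1 \<le> i \<and> i < j \<and> j \<le> int n \<and> hyperplane_height n i j k = int m"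
      then consider "j - k * int n = i + int m" | "j - k * int n = i - int m"
        unfolding hyperplane_height_def by linarith
      then show "i < j - k * int n \<longleftrightarrow> u i < u (j - k * int n)"
      proof cases
        case 1 then show ?thesis using S m by simp
      next
        case 2 then show ?thesis using S[rule_format, of "i - int m"] m by simp
      qed
    qed
  qed
  finally show ?thesis .
qed

lemma inv_in_sommers_perms_iff:
  assumes "n > 0" and "m > 0" and w: "w \<in> affine_sym_group n"
  shows "inv w \<in> sommers_perms m n \<longleftrightarrow> (\<forall>i j. i < j \<longrightarrow> w i - w j \<noteq> int m)"
proof -
  have b: "bij w" using w by (simp add: affine_sym_group_def)
  have wi: "w (inv w a) = a" and iw: "inv w (w a) = a" for a
    using b by (simp_all add: bij_is_surj bij_is_inj surj_f_inv_f inv_f_f)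
  have "(\<forall>a. inv w a < inv w (a + int m)) \<longleftrightarrow> (\<forall>i j. i < j \<longrightarrow> w i - w j \<noteq> int m)"
  proof (intro iffI allI impI)
    fix i j :: int assume S: "\<forall>a. inv w a < inv w (a + int m)" and "i < j"
    show "w i - w j \<noteq> int m"
    proof
      assume "w i - w j = int m"
      then have "w i = w j + int m" by simp
      then have "inv w (w j) < inv w (w i)" using S by metis
      then show False using iw \<open>i < j\<close> by simp
    qed
  next
    fix a assume S: "\<forall>i j. i < j \<longrightarrow> w i - w j \<noteq> int m"
    have "\<not> inv w (a + int m) < inv w a"
      using S[rule_format, of "inv w (a + int m)" "inv w a"] by (auto simp: wi)
    moreover have "inv w (a + int m) \<noteq> inv w a"
      using wi[of a] wi[of "a + int m"] \<open>m > 0\<close> by auto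
    ultimately show "inv w a < inv w (a + int m)" by simp
  qed
  then show ?thesis using sommers_perms_iff[of n m "inv w"] inv_affine[of n w] assms by simp
qed

end

theory Submission
  imports Defs
begin

text \<open>
  For \<open>w\<close> with \<open>w\<^sup>-\<^sup>1\<close> in the Sommers region, the set \<open>A i\<close> of values of \<open>w\<close> on \<open>{i..}\<close> is closed under
  adding \<open>m\<close>, so it is given by the sorted tuple of its \<open>m\<close> minimal representatives modulo \<open>m\<close>.
  Passing from \<open>A i\<close> to \<open>A (i + 1)\<close> replaces the entry \<open>w i\<close> by \<open>w i + m\<close>, and the letter
  \<open>p\<^sub>i\<close> is the rank of that entry. Hence \<open>B w = p\<close> exactly when the word \<open>p\<close>, acting
  on sorted tuples, shifts the tuple of \<open>A 1\<close> by \<open>n\<close>, and \<open>w\<close> is recovered from \<open>p\<close> and this tuple.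

  It remains to see that a word shifts some integer tuple by \<open>n\<close> iff it is a parking word, and that the
  tuple is then unique up to translation. Necessity of the parking condition follows from the sums of
  the \<open>i\<close> smallest entries. For existence, the action of \<open>p\<close> minus \<open>n\<close> is monotone, preserves the
  sum of the entries, and for a parking word has a bounded orbit; the pointwise maximum of an
  eventual period is a fixed point. By coprimality a fixed tuple is a complete residue system modulo
  \<open>m\<close>, so its sum is determined modulo \<open>m\<close>. Pointwise maxima of fixed tuples are fixed; if \<open>x\<close> and
  \<open>y\<close> were fixed and not translates, the maximum of \<open>x\<close> and a suitable translate of \<open>y\<close> would
  exceed \<open>x\<close> by \<open>1\<close> in between \<open>1\<close> and \<open>m - 1\<close> entries, contradicting the congruence of the sums.
\<close>

section \<open>The action of words on sorted tuples\<close>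

text \<open>One letter \<open>p\<close> acts on a sorted tuple \<open>x 0, \<dots>, x (m - 1)\<close> by adding \<open>m\<close> to the entry \<open>x p\<close> and
  sorting again; values at indices from \<open>m\<close> on are irrelevant.\<close>

definition bump :: "nat \<Rightarrow> nat \<Rightarrow> (nat \<Rightarrow> int) \<Rightarrow> nat \<Rightarrow> int" where
  "bump m p x k =
     (if k < p then x k
      else max (x k) (if Suc k < m then min (x (Suc k)) (x p + int m) else x p + int m))"

lemma bump_ge: "x k \<le> bump m p x k"
  by (simp add: bump_def)

lemma bump_le:
  assumes "mono_on {..<m} x" "p < m" "k < m"
  shows "bump m p x k \<le> x k + int m"
proof (cases "k < p")
  case False
  then have "x p \<le> x k" using assms by (auto intro: mono_onD)
  then show ?thesis by (auto simp: bump_def)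
qed (simp add: bump_def)

lemma bump_le_next:
  assumes "mono_on {..<m} x" "Suc k < m"
  shows "bump m p x k \<le> x (Suc k)"
proof -
  have "x k \<le> x (Suc k)" using assms by (auto intro: mono_onD)
  then show ?thesis using assms by (auto simp: bump_def)
qed

lemma mono_on_bump:
  assumes x: "mono_on {..<m} x"
  shows "mono_on {..<m} (bump m p x)"
proof (rule mono_onI)
  fix i j assume ij: "i \<in> {..<m}" "j \<in> {..<m}" "i \<le> j"
  show "bump m p x i \<le> bump m p x j"
  proof (cases "i = j")
    case False
    then have "bump m p x i \<le> x (Suc i)" using ij by (intro bump_le_next x) auto
    also have "\<dots> \<le> x j" using False ij by (intro mono_onD[OF x]) auto
    also have "\<dots> \<le> bump m p x j" by (rule bump_ge)
    finally show ?thesis .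
  qed simp
qed

lemma bump_mono:
  assumes "\<And>k. k < m \<Longrightarrow> x k \<le> y k" "p < m" "k < m"
  shows "bump m p x k \<le> bump m p y k"
  unfolding bump_def using assms(1)[of k] assms(1)[of p] assms(1)[of "Suc k"] assms(2,3) by auto

lemma bump_add: "bump m p (\<lambda>k. x k + c) = (\<lambda>k. bump m p x k + c)"
  by (auto simp: bump_def fun_eq_iff)

text \<open>The new entry is the maximum of \<open>x k\<close> and the value inside the middle
  \<open>h\<close>; their minimum is \<open>min (x k) (x p + int m)\<close>, as \<open>x\<close> is
  sorted. Arbitrary \<open>h\<close> expresses equality of multisets, and the identity telescopes in
  \<open>k\<close>.\<close>

lemma fun_bump:
  fixes h :: "int \<Rightarrow> int"
  assumes "mono_on {..<m} x" "k < m" "p \<le> k"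
  shows "h (bump m p x k) =
    h (x k) + h (if Suc k < m then min (x (Suc k)) (x p + int m) else x p + int m)
      - h (min (x k) (x p + int m))"
proof -
  have "x k \<le> x (Suc k)" if "Suc k < m"
    using assms that by (auto intro: mono_onD)
  then show ?thesis
    using assms by (cases "x k \<le> x p + int m") (auto simp: bump_def min_def max_def)
qed

text \<open>Telescoping \<open>fun_bump\<close> from \<open>k = p\<close> on: if
  \<open>p < i\<close>, the first \<open>i\<close> positions lose \<open>x p\<close> and gain
  \<open>min (x i) (x p + int m)\<close>.\<close>

lemma sum_bump_less:
  fixes h :: "int \<Rightarrow> int"
  assumes x: "mono_on {..<m} x" and p: "p < m" and "i < m"
  shows "(\<Sum>k<i. h (bump m p x k)) =
    (\<Sum>k<i. h (x k)) + (if p < i then h (min (x i) (x p + int m)) - h (x p) else 0)"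
  using \<open>i < m\<close>
proof (induction i)
  case (Suc i)
  consider "i < p" | "i = p" | "p < i" by linarith
  then show ?case
  proof cases
    case 1
    then show ?thesis using Suc by (simp add: bump_def)
  next
    case 2
    have "h (bump m p x i) = h (x i) + h (min (x (Suc i)) (x p + int m)) - h (min (x i) (x p + int m))"
      using fun_bump[OF x, of i p h] Suc 2 by simp
    then show ?thesis using Suc 2 by simp
  next
    case 3
    have "h (bump m p x i) = h (x i) + h (min (x (Suc i)) (x p + int m)) - h (min (x i) (x p + int m))"
      using fun_bump[OF x, of i p h] Suc 3 by simp
    then show ?thesis using Suc 3 by simp
  qed
qed simp

text \<open>As a multiset, the tuple loses \<open>x p\<close> and gains \<open>x p + int m\<close>.
  Choices of \<open>h\<close> yield statements on sums, residues and membership.\<close>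

lemma sum_bump:
  fixes h :: "int \<Rightarrow> int"
  assumes x: "mono_on {..<m} x" and p: "p < m"
  shows "(\<Sum>k<m. h (bump m p x k)) = (\<Sum>k<m. h (x k)) + h (x p + int m) - h (x p)"
proof -
  obtain i where i: "m = Suc i" using p by (cases m) auto
  have "h (bump m p x i) = h (x i) + h (x p + int m) - h (min (x i) (x p + int m))"
    using fun_bump[OF x, of i p h] p i by simp
  then show ?thesis
    using sum_bump_less[OF x p, of i h] i p by (cases "p = i") (simp_all add: i)
qed

lemma mono_on_fold_bump:
  "mono_on {..<m} x \<Longrightarrow> mono_on {..<m} (fold (bump m) p x)"
  by (induction p arbitrary: x) (simp_all add: mono_on_bump)

lemma fold_bump_ge: "x k \<le> fold (bump m) p x k"
  by (induction p arbitrary: x) (auto intro: order_trans[OF bump_ge])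

lemma fold_bump_mono:
  assumes "\<And>k. k < m \<Longrightarrow> x k \<le> y k" "set p \<subseteq> {..<m}" "k < m"
  shows "fold (bump m) p x k \<le> fold (bump m) p y k"
  using assms by (induction p arbitrary: x y) (simp_all add: bump_mono)

lemma fold_bump_cong:
  assumes "\<And>k. k < m \<Longrightarrow> x k = y k" "set p \<subseteq> {..<m}" "k < m"
  shows "fold (bump m) p x k = fold (bump m) p y k"
  using assms by (intro antisym fold_bump_mono) auto

lemma fold_bump_add: "fold (bump m) p (\<lambda>k. x k + c) = (\<lambda>k. fold (bump m) p x k + c)"
  by (induction p arbitrary: x) (simp_all add: bump_add)

lemma sum_fold_bump:
  assumes "mono_on {..<m} x" "set p \<subseteq> {..<m}"
  shows "(\<Sum>k<m. fold (bump m) p x k) = (\<Sum>k<m. x k) + int m * int (length p)"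
  using assms
proof (induction p arbitrary: x)
  case (Cons a p)
  then show ?case
    using sum_bump[of m x a "\<lambda>t. t"] by (simp add: mono_on_bump algebra_simps)
qed simp

lemma sum_periodic_fold_bump:
  fixes h :: "int \<Rightarrow> int"
  assumes "mono_on {..<m} x" "set p \<subseteq> {..<m}" "\<And>t. h (t + int m) = h t"
  shows "(\<Sum>k<m. h (fold (bump m) p x k)) = (\<Sum>k<m. h (x k))"
  using assms(1,2)
proof (induction p arbitrary: x)
  case (Cons a p)
  then show ?case
    using sum_bump[of m x a h] assms(3) by (simp add: mono_on_bump)
qed simp

text \<open>A letter \<open>a < i\<close> raises the sum of the first \<open>i\<close> entries by
  \<open>min (x i) (x a + int m) - x a\<close>, hence by at most \<open>m\<close>; other letters
  leave it unchanged.\<close>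

lemma partial_sum_fold_bump_le:
  assumes "mono_on {..<m} x" "set p \<subseteq> {..<m}" "i < m"
  shows "(\<Sum>k<i. fold (bump m) p x k)
    \<le> (\<Sum>k<i. x k) + int m * int (length (filter (\<lambda>a. a < i) p))"
  using assms(1,2)
proof (induction p arbitrary: x)
  case (Cons a p)
  have "(\<Sum>k<i. fold (bump m) p (bump m a x) k)
    \<le> (\<Sum>k<i. bump m a x k) + int m * int (length (filter (\<lambda>a. a < i) p))"
    using Cons by (simp add: mono_on_bump)
  moreover have "(\<Sum>k<i. bump m a x k) \<le> (\<Sum>k<i. x k) + (if a < i then int m else 0)"
    using sum_bump_less[of m x a i "\<lambda>t. t"] Cons.prems assms(3) by (auto simp: min_def)
  ultimately show ?case by (simp add: algebra_simps split: if_splits)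
qed simp

text \<open>A gap of at least \<open>length p * m\<close> below index \<open>i\<close> cannot be closed while \<open>p\<close> acts, so the lower
  and the upper entries do not interact.\<close>

lemma partial_sum_fold_bump_gap:
  assumes "mono_on {..<m} x" "set p \<subseteq> {..<m}" "Suc i < m"
    "x (Suc i) - x i \<ge> int (length p) * int m"
  shows "(\<Sum>k<Suc i. fold (bump m) p x k)
    = (\<Sum>k<Suc i. x k) + int m * int (length (filter (\<lambda>a. a < Suc i) p))"
  using assms(1,2,4)
proof (induction p arbitrary: x)
  case (Cons a p)
  have a: "a < m" using Cons.prems by simp
  have "bump m a x i \<le> x i + int m"
    using Cons.prems a assms(3) by (intro bump_le) auto
  moreover have "x (Suc i) \<le> bump m a x (Suc i)" by (rule bump_ge)
  ultimately have "bump m a x (Suc i) - bump m a x i \<ge> int (length p) * int m"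
    using Cons.prems(3) by (simp add: algebra_simps)
  then have "(\<Sum>k<Suc i. fold (bump m) p (bump m a x) k)
    = (\<Sum>k<Suc i. bump m a x k) + int m * int (length (filter (\<lambda>a. a < Suc i) p))"
    using Cons by (simp add: mono_on_bump del: sum.lessThan_Suc)
  moreover have "(\<Sum>k<Suc i. bump m a x k) = (\<Sum>k<Suc i. x k) + (if a < Suc i then int m else 0)"
  proof -
    have "x a + int m \<le> x (Suc i)" if "a < Suc i"
    proof -
      have "x a \<le> x i" using that assms(3) by (intro mono_onD[OF Cons.prems(1)]) auto
      moreover have "int m \<le> int (length (a # p)) * int m" by (simp add: algebra_simps)
      ultimately show ?thesis using Cons.prems(3) by linarith
    qed
    then show ?thesis
      using sum_bump_less[OF Cons.prems(1) a assms(3), of "\<lambda>t. t"] by (simp del: sum.lessThan_Suc)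
  qed
  ultimately show ?case by (simp add: algebra_simps split: if_splits)
qed simp

section \<open>Parking words and tuples shifted by the length of the word\<close>

lemma parking_words_iff:
  assumes "m > 0"
  shows "p \<in> parking_words m n \<longleftrightarrow> length p = n \<and> set p \<subseteq> {..<m} \<and>
    (\<forall>i\<in>{1..m}. int i * int n \<le> int m * int (length (filter (\<lambda>a. a < i) p)))"
proof -
  have "real (card {j. j < length p \<and> p ! j < i}) \<ge> real (i * length p) / real m \<longleftrightarrow>
    int i * int (length p) \<le> int m * int (length (filter (\<lambda>a. a < i) p))" for i
  proof -
    have "real (card {j. j < length p \<and> p ! j < i}) \<ge> real (i * length p) / real m \<longleftrightarrow>
      real (i * length p) \<le> real (m * length (filter (\<lambda>a. a < i) p))"
      using assms by (simp add: length_filter_conv_card divide_le_eq mult.commute)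
    also have "\<dots> \<longleftrightarrow> i * length p \<le> m * length (filter (\<lambda>a. a < i) p)"
      by (rule of_nat_le_iff)
    also have "\<dots> \<longleftrightarrow> int i * int (length p) \<le> int m * int (length (filter (\<lambda>a. a < i) p))"
      by (metis of_nat_le_iff of_nat_mult)
    finally show ?thesis .
  qed
  then show ?thesis by (auto simp: parking_words_def lessThan_atLeast0)
qed

definition fixes_up_to_shift :: "nat \<Rightarrow> nat list \<Rightarrow> (nat \<Rightarrow> int) \<Rightarrow> bool" where
  "fixes_up_to_shift m p x \<longleftrightarrow>
     mono_on {..<m} x \<and> (\<forall>k<m. fold (bump m) p x k = x k + int (length p))"

lemma parking_if_fixed:
  assumes "m > 0" and p: "set p \<subseteq> {..<m}" and fx: "fixes_up_to_shift m p x"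
  shows "p \<in> parking_words m (length p)"
proof -
  have x: "mono_on {..<m} x" using fx by (simp add: fixes_up_to_shift_def)
  have "int i * int (length p) \<le> int m * int (length (filter (\<lambda>a. a < i) p))"
    if "i \<in> {1..m}" for i
  proof (cases "i = m")
    case True
    then have "filter (\<lambda>a. a < i) p = p" using p by (auto simp: filter_id_conv)
    then show ?thesis using True by simp
  next
    case False
    then have i: "i < m" using that by simp
    have "(\<Sum>k<i. fold (bump m) p x k) = (\<Sum>k<i. x k + int (length p))"
      using i fx by (intro sum.cong) (auto simp: fixes_up_to_shift_def)
    then show ?thesis
      using partial_sum_fold_bump_le[OF x p i] by (simp add: sum.distrib)
  qed
  then show ?thesis using assms(1) p by (simp add: parking_words_iff)
qed

text \<open>Any inequality between a configuration and its image is an equality, because the sum of the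
  entries is preserved.\<close>

lemma fixed_if_le:
  assumes x: "mono_on {..<m} x" and p: "set p \<subseteq> {..<m}"
    and le: "\<And>k. k < m \<Longrightarrow> x k + int (length p) \<le> fold (bump m) p x k"
  shows "fixes_up_to_shift m p x"
proof -
  have eq: "(\<Sum>k<m. x k + int (length p)) = (\<Sum>k<m. fold (bump m) p x k)"
    using sum_fold_bump[OF x p] by (simp add: sum.distrib)
  have "x k + int (length p) = fold (bump m) p x k" if "k < m" for k
    using that le by (intro sum_mono_inv[OF eq]) auto
  then show ?thesis using x by (simp add: fixes_up_to_shift_def)
qed

lemma mono_on_max:
  fixes x y :: "nat \<Rightarrow> int"
  assumes "mono_on A x" "mono_on A y"
  shows "mono_on A (\<lambda>k. max (x k) (y k))"
  by (rule mono_onI, rule max.mono) (rule mono_onD[OF assms(1)] mono_onD[OF assms(2)], assumption+)+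

text \<open>Monotonicity of the action gives only an inequality; \<open>fixed_if_le\<close> makes it
  an equality.\<close>

lemma fixed_max:
  assumes x: "fixes_up_to_shift m p x" and y: "fixes_up_to_shift m p y" and p: "set p \<subseteq> {..<m}"
  shows "fixes_up_to_shift m p (\<lambda>k. max (x k) (y k))"
proof (rule fixed_if_le)
  fix k assume k: "k < m"
  have "fold (bump m) p x k \<le> fold (bump m) p (\<lambda>k. max (x k) (y k)) k"
    "fold (bump m) p y k \<le> fold (bump m) p (\<lambda>k. max (x k) (y k)) k"
    using k p by (auto intro!: fold_bump_mono)
  then show "max (x k) (y k) + int (length p) \<le> fold (bump m) p (\<lambda>k. max (x k) (y k)) k"
    using x y k by (auto simp: fixes_up_to_shift_def)
qed (use assms in \<open>auto simp: fixes_up_to_shift_def intro: mono_on_max\<close>)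

lemma fixed_add:
  "fixes_up_to_shift m p x \<Longrightarrow> fixes_up_to_shift m p (\<lambda>k. x k + c)"
  by (auto simp: fixes_up_to_shift_def fold_bump_add mono_on_def)

section \<open>Residues modulo \<open>m\<close> and uniqueness up to translation\<close>

lemma coprime_multiple_cong:
  fixes d :: int
  assumes "coprime m n" "m > 0"
  obtains j :: nat where "(int j * int n) mod int m = d mod int m"
proof -
  have "coprime (int m) (int n)" using assms by simp
  then obtain a b where ab: "a * int m + b * int n = 1"
    by (metis bezout_int coprime_imp_gcd_eq_1)
  define j where "j = nat ((d * b) mod int m)"
  have "int j = (d * b) mod int m" using assms by (simp add: j_def)
  then have "(int j * int n) mod int m = (d * b * int n) mod int m"
    by (simp add: mod_mult_left_eq)
  also have "d * b * int n = d * (1 - a * int m)"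
  proof -
    have "b * int n = 1 - a * int m" using ab by simp
    then show ?thesis by (simp add: mult.assoc)
  qed
  also have "\<dots> = d + (- d * a) * int m" by (simp add: algebra_simps)
  also have "\<dots> mod int m = d mod int m" by (rule mod_mult_self1)
  finally show ?thesis using that by blast
qed

definition residue_system :: "nat \<Rightarrow> (nat \<Rightarrow> int) \<Rightarrow> bool" where
  "residue_system m x \<longleftrightarrow> mono_on {..<m} x \<and> bij_betw (\<lambda>k. x k mod int m) {..<m} {0..<int m}"

lemma residue_systemI:
  assumes m: "m > 0" and "mono_on {..<m} x" and ex: "\<And>t. \<exists>k<m. x k mod int m = t mod int m"
  shows "residue_system m x"
proof -
  have "(\<lambda>k. x k mod int m) ` {..<m} = {0..<int m}"
  proof
    show "{0..<int m} \<subseteq> (\<lambda>k. x k mod int m) ` {..<m}"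
    proof
      fix t assume "t \<in> {0..<int m}"
      then have "t = t mod int m" by simp
      then show "t \<in> (\<lambda>k. x k mod int m) ` {..<m}" using ex[of t] by (metis imageI lessThan_iff)
    qed
  qed (use m in auto)
  moreover from this have "inj_on (\<lambda>k. x k mod int m) {..<m}"
    by (intro eq_card_imp_inj_on) simp_all
  ultimately show ?thesis using assms by (simp add: residue_system_def bij_betw_def)
qed

text \<open>The multiset of residues of a fixed configuration is invariant under adding \<open>n\<close>, hence, by
  coprimality, under adding anything.\<close>

lemma residue_system_if_fixed:
  assumes m: "m > 0" and p: "set p \<subseteq> {..<m}" and cop: "coprime m (length p)"
    and fx: "fixes_up_to_shift m p x"
  shows "residue_system m x"
proof (rule residue_systemI)
  show x: "mono_on {..<m} x" using fx by (simp add: fixes_up_to_shift_def)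
  fix t
  define h :: "int \<Rightarrow> int \<Rightarrow> int" where "h r s = of_bool ((s - r) mod int m = 0)" for r s
  have "(\<Sum>k<m. h (r + int (length p)) (x k)) = (\<Sum>k<m. h r (x k))" for r
  proof -
    define r' where "r' = r + int (length p)"
    have "h r' (s + int m) = h r' s" for s
    proof -
      have "s + int m - r' = (s - r') + int m" by simp
      then show ?thesis unfolding h_def by (simp only: mod_add_self2)
    qed
    then have "(\<Sum>k<m. h r' (x k)) = (\<Sum>k<m. h r' (fold (bump m) p x k))"
      using sum_periodic_fold_bump[OF x p, of "h r'"] by simp
    also have "\<dots> = (\<Sum>k<m. h r (x k))"
      using fx by (intro sum.cong) (auto simp: fixes_up_to_shift_def h_def r'_def)
    finally show ?thesis by (simp add: r'_def)
  qed
  note shift = this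
  have shifts: "(\<Sum>k<m. h (r + int j * int (length p)) (x k)) = (\<Sum>k<m. h r (x k))" for r j
  proof (induction j)
    case (Suc j)
    have e: "r + int (Suc j) * int (length p) = (r + int j * int (length p)) + int (length p)"
      by (simp add: algebra_simps)
    show ?case unfolding e using shift[of "r + int j * int (length p)"] Suc by simp
  qed simp
  obtain j where "(int j * int (length p)) mod int m = (t - x 0) mod int m"
    using coprime_multiple_cong[OF cop m] by blast
  then have j: "(x 0 + int j * int (length p)) mod int m = t mod int m"
    by (metis add.commute diff_add_cancel mod_add_left_eq)
  \<comment> \<open>The sum of \<open>h r\<close> counts the entries congruent to \<open>r\<close>.
    The class of \<open>x 0\<close> contains \<open>x 0\<close>, and invariance of the counts
    carries this to the class of \<open>t\<close>.\<close>
  have "0 < (\<Sum>k<m. h (x 0) (x k))"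
    using m by (intro sum_pos2[of _ 0]) (auto simp: h_def)
  then have "0 < (\<Sum>k<m. h (x 0 + int j * int (length p)) (x k))" by (simp add: shifts)
  then have "\<exists>k\<in>{..<m}. h (x 0 + int j * int (length p)) (x k) \<noteq> 0"
    by (rule contrapos_pp) simp
  then obtain k where k: "k < m" "h (x 0 + int j * int (length p)) (x k) \<noteq> 0" by auto
  then have "x k mod int m = (x 0 + int j * int (length p)) mod int m"
    by (simp add: h_def mod_eq_dvd_iff dvd_eq_mod_eq_0)
  then show "\<exists>k<m. x k mod int m = t mod int m" using j k(1) by auto
qed (rule m)

lemma residue_system_sum:
  assumes "residue_system m x"
  shows "(\<Sum>k<m. x k) mod int m = (\<Sum>{0..<int m}) mod int m"
proof -
  have "(\<Sum>k<m. x k mod int m) = (\<Sum>{0..<int m})"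
    using assms sum.reindex_bij_betw[of "\<lambda>k. x k mod int m" _ _ "\<lambda>t. t"]
    by (simp add: residue_system_def)
  then show ?thesis by (metis mod_sum_eq)
qed

lemma fixed_unique:
  assumes m: "m > 0" and p: "set p \<subseteq> {..<m}" and cop: "coprime m (length p)"
    and x: "fixes_up_to_shift m p x" and y: "fixes_up_to_shift m p y"
  obtains c where "\<And>k. k < m \<Longrightarrow> x k = y k + c"
proof -
  define D where "D = (\<lambda>k. x k - y k) ` {..<m}"
  have D: "finite D" "D \<noteq> {}" using m by (auto simp: D_def)
  define c where "c = Min D"
  have le: "y k + c \<le> x k" if "k < m" for k
  proof -
    have "x k - y k \<in> D" using that by (simp add: D_def)
    then have "c \<le> x k - y k" unfolding c_def by (rule Min_le[OF D(1)])
    then show ?thesis by simp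
  qed
  define E where "E = {k. k < m \<and> x k = y k + c}"
  have "c \<in> D" unfolding c_def using D by (rule Min_in)
  then have "E \<noteq> {}" by (auto simp: D_def E_def)
  \<comment> \<open>As \<open>c\<close> is the least difference, this maximum exceeds
    \<open>x\<close> by exactly \<open>1\<close> on \<open>E\<close> and equals \<open>x\<close>
    elsewhere.\<close>
  define z where "z k = max (x k) (y k + (c + 1))" for k
  have "fixes_up_to_shift m p z" unfolding z_def by (intro fixed_max fixed_add x y p)
  then have "(\<Sum>k<m. z k) mod int m = (\<Sum>k<m. x k) mod int m"
    using x by (simp add: residue_system_sum residue_system_if_fixed[OF m p cop])
  moreover have "(\<Sum>k<m. z k) = (\<Sum>k<m. x k) + int (card E)"
  proof -
    have "(\<Sum>k<m. z k) = (\<Sum>k<m. x k + of_bool (x k = y k + c))"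
      using le by (intro sum.cong) (force simp: z_def)+
    also have "\<dots> = (\<Sum>k<m. x k) + int (card ({..<m} \<inter> {k. x k = y k + c}))"
      by (simp add: sum.distrib sum_of_bool_eq)
    also have "{..<m} \<inter> {k. x k = y k + c} = E" by (auto simp: E_def)
    finally show ?thesis .
  qed
  ultimately have "int m dvd int (card E)" by (metis add_diff_cancel_left' mod_eq_dvd_iff)
  moreover have E: "E \<subseteq> {..<m}" by (auto simp: E_def)
  then have "card E > 0" using \<open>E \<noteq> {}\<close> finite_subset by (fastforce simp: card_gt_0_iff)
  ultimately have "m \<le> card E" by (simp add: dvd_imp_le)
  then have "E = {..<m}" using E by (intro card_seteq) auto
  then show ?thesis using that by (auto simp: E_def)
qed

section \<open>Existence of fixed tuples\<close>

text \<open>The bounds on the partial sums form a region invariant under \<open>p\<close> followed by subtraction of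
  \<open>length p\<close>: they are strictly concave in \<open>i\<close>, so a partial sum that is close to its bound forces a
  large gap at \<open>i\<close>, and then the parking condition keeps that partial sum from decreasing.\<close>

definition bounded_config :: "nat \<Rightarrow> nat \<Rightarrow> (nat \<Rightarrow> int) \<Rightarrow> bool" where
  "bounded_config m n x \<longleftrightarrow> mono_on {..<m} x \<and> (\<Sum>k<m. x k) = 0 \<and>
     (\<forall>i\<le>m. - (2 * int n * int m * (int i * (int m - int i))) \<le> (\<Sum>k<i. x k))"

lemma bounded_config_step:
  assumes p: "p \<in> parking_words m n" and m: "m > 0" and x: "bounded_config m n x"
  shows "bounded_config m n (\<lambda>k. fold (bump m) p x k - int n)"
proof -
  define C where "C = 2 * int n * int m"
  define L where "L i = (\<Sum>k<i. x k)" for i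
  have len: "length p = n" and sp: "set p \<subseteq> {..<m}"
    and park: "\<And>i. i \<in> {1..m} \<Longrightarrow> int i * int n \<le> int m * int (length (filter (\<lambda>a. a < i) p))"
    using p m by (auto simp: parking_words_iff)
  have mx: "mono_on {..<m} x" and L0: "L m = 0"
    and Lb: "\<And>i. i \<le> m \<Longrightarrow> - (C * (int i * (int m - int i))) \<le> L i"
    using x by (auto simp: bounded_config_def L_def C_def)
  have S: "(\<Sum>k<i. fold (bump m) p x k - int n) = (\<Sum>k<i. fold (bump m) p x k) - int i * int n" for i
    by (simp add: sum_subtractf)
  have ge: "L i - int i * int n \<le> (\<Sum>k<i. fold (bump m) p x k - int n)" for i
    unfolding S L_def by (simp add: sum_mono fold_bump_ge)
  have total: "(\<Sum>k<m. fold (bump m) p x k - int n) = 0"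
    unfolding S using sum_fold_bump[OF mx sp] L0 len by (simp add: L_def)
  have "- (C * (int i * (int m - int i))) \<le> (\<Sum>k<i. fold (bump m) p x k - int n)" if i: "i \<le> m" for i
  proof -
    consider "i = 0" | "i = m" | l where "i = Suc l" "Suc l < m"
      using i by (cases i) (auto simp: le_less)
    then show ?thesis
    proof cases
      case 3
      show ?thesis
      proof (cases "x (Suc l) - x l \<ge> int n * int m")
        case True
        then have "(\<Sum>k<i. fold (bump m) p x k)
          = L i + int m * int (length (filter (\<lambda>a. a < i) p))"
          using partial_sum_fold_bump_gap[OF mx sp, of l] 3 len by (simp add: L_def)
        then have "L i \<le> (\<Sum>k<i. fold (bump m) p x k - int n)"
          unfolding S using park[of i] 3 by simp
        then show ?thesis using Lb[OF i] by linarith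
      next
        case False
        have Ll: "- (C * (int l * (int m - int l))) \<le> L l"
          and Lr: "- (C * ((int l + 2) * (int m - (int l + 2)))) \<le> L (Suc (Suc l))"
          using Lb[of l] Lb[of "Suc (Suc l)"] 3 by (simp_all add: algebra_simps)
        have "L (Suc (Suc l)) = L l + x l + x (Suc l)" "L i = L l + x l"
          using 3 by (simp_all add: L_def)
        \<comment> \<open>Without the gap the second difference of \<open>L\<close> at
          \<open>i\<close> is below \<open>n * m\<close>, while that of the lower bound is
          \<open>2 * C\<close>. So \<open>L i\<close> exceeds its bound by more than
          \<open>C - n * m / 2\<close>, which covers the loss of at most \<open>i * n\<close> in
          \<open>ge\<close>.\<close>
        then have "2 * L i > L l + L (Suc (Suc l)) - int n * int m" using False by simp
        moreover have "C * (int l * (int m - int l)) + C * ((int l + 2) * (int m - (int l + 2)))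
          = 2 * (C * (int i * (int m - int i))) - 2 * C"
          using 3 by (simp add: algebra_simps)
        ultimately have "2 * L i > - 2 * (C * (int i * (int m - int i))) + 2 * C - int n * int m"
          using Ll Lr by linarith
        moreover have "int i * int n \<le> int m * int n" using i by (intro mult_right_mono) auto
        moreover have "2 * C = 4 * (int m * int n)" by (simp add: C_def)
        moreover have "int n * int m = int m * int n" "0 \<le> int m * int n" by simp_all
        ultimately show ?thesis using ge[of i] by linarith
      qed
    qed (use total in auto)
  qed
  moreover have "mono_on {..<m} (\<lambda>k. fold (bump m) p x k - int n)"
    using mono_on_fold_bump[OF mx, of p] by (simp add: mono_on_def)
  ultimately show ?thesis using total by (simp add: bounded_config_def C_def)
qed

text \<open>The bound at \<open>i = 1\<close> controls the smallest entry from below; the bound at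
  \<open>i = m - 1\<close>, with total sum \<open>0\<close>, controls the largest from
  above.\<close>

lemma bounded_config_bound:
  assumes x: "bounded_config m n x" and k: "k < m"
  shows "\<bar>x k\<bar> \<le> 2 * int n * int m * int m"
proof -
  define C where "C = 2 * int n * int m"
  have C: "C \<ge> 0" by (simp add: C_def)
  have mx: "mono_on {..<m} x" and tot: "(\<Sum>k<m. x k) = 0"
    and Lb: "\<And>i. i \<le> m \<Longrightarrow> - (C * (int i * (int m - int i))) \<le> (\<Sum>k<i. x k)"
    using x by (auto simp: bounded_config_def C_def)
  obtain l where l: "m = Suc l" using k by (cases m) auto
  have "x 0 \<le> x k" "x k \<le> x l" using k l by (auto intro!: mono_onD[OF mx])
  moreover have "- (C * int l) \<le> x 0" using Lb[of 1] l by simp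
  moreover have "x l \<le> C * int l" using Lb[of l] tot l by simp
  moreover have "C * int l \<le> C * int m" using C l by (intro mult_left_mono) auto
  ultimately show ?thesis unfolding C_def by linarith
qed

text \<open>An orbit in the finite invariant region is eventually periodic. The pointwise maximum of a
  period is mapped above itself, hence it is fixed.\<close>

lemma fixed_exists:
  assumes p: "p \<in> parking_words m n" and m: "m > 0"
  obtains x where "fixes_up_to_shift m p x"
proof -
  define f where "f x k = fold (bump m) p x k - int n" for x k
  define s where "s j = (f ^^ j) (\<lambda>_. 0)" for j
  have len: "length p = n" and sp: "set p \<subseteq> {..<m}"
    using p m by (auto simp: parking_words_iff)
  have s_Suc: "s (Suc j) k = fold (bump m) p (s j) k - int n" for j k
    by (simp add: s_def f_def)
  have bc: "bounded_config m n (s j)" for j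
  proof (induction j)
    case 0
    then show ?case by (simp add: s_def bounded_config_def mono_on_def)
  next
    case (Suc j)
    have "s (Suc j) = (\<lambda>k. fold (bump m) p (s j) k - int n)" by (simp add: s_Suc fun_eq_iff)
    then show ?case using bounded_config_step[OF p m Suc] by simp
  qed
  define K where "K = 2 * int n * int m * int m"
  \<comment> \<open>Only indices below \<open>m\<close> matter; restriction puts the orbit into a
    finite function space.\<close>
  define t where "t j = restrict (s j) {..<m}" for j
  have "s j k \<in> {-K..K}" if "k < m" for j k
    using bounded_config_bound[OF bc that, of j] by (auto simp: K_def abs_le_iff)
  then have "t j \<in> {..<m} \<rightarrow>\<^sub>E {-K..K}" for j
    by (simp add: t_def restrict_PiE_iff del: atLeastAtMost_iff)
  then have "range t \<subseteq> {..<m} \<rightarrow>\<^sub>E {-K..K}" by blast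
  then have "finite (range t)" by (rule finite_subset) (simp add: finite_PiE)
  then have "\<not> inj t" using finite_imageD by blast
  then obtain a b where "t a = t b" "a < b" by (metis injI linorder_neqE_nat)
  then have ab: "s a k = s b k" if "k < m" for k
    using that by (metis lessThan_iff restrict_apply' t_def)
  define z where "z k = Max ((\<lambda>j. s j k) ` {a..<b})" for k
  have sz: "s j k \<le> z k" if "j \<in> {a..<b}" for j k
    unfolding z_def using that by (intro Max_ge) auto
  have zI: "z k \<le> u" if "\<And>j. j \<in> {a..<b} \<Longrightarrow> s j k \<le> u" for k u
    unfolding z_def using that \<open>a < b\<close> by (subst Max_le_iff) auto
  have "fixes_up_to_shift m p z"
  proof (rule fixed_if_le)
    show "mono_on {..<m} z"
    proof (intro mono_onI zI)
      fix k l j assume kl: "k \<in> {..<m}" "l \<in> {..<m}" "k \<le> l" and j: "j \<in> {a..<b}"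
      have "mono_on {..<m} (s j)" using bc[of j] by (simp add: bounded_config_def)
      then have "s j k \<le> s j l" using kl by (rule mono_onD)
      also have "\<dots> \<le> z l" using j by (rule sz)
      finally show "s j k \<le> z l" .
    qed
  next
    fix k assume k: "k < m"
    have "z k \<le> fold (bump m) p z k - int n"
    proof (rule zI)
      fix j assume j: "j \<in> {a..<b}"
      \<comment> \<open>Each \<open>s j\<close> of the period has a predecessor in it; for
        \<open>j = a\<close> this is \<open>s (b - 1)\<close>, since \<open>s a\<close> and
        \<open>s b\<close> agree below \<open>m\<close>.\<close>
      obtain j' where j': "j' \<in> {a..<b}" "s j k = s (Suc j') k"
      proof (cases "j = a")
        case True
        then show ?thesis using that[of "b - 1"] \<open>a < b\<close> ab[OF k] by simp
      next
        case False
        then show ?thesis using j by (intro that[of "j - 1"]) auto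
      qed
      have "fold (bump m) p (s j') k \<le> fold (bump m) p z k"
        using sz[OF j'(1)] sp k by (intro fold_bump_mono) auto
      then show "s j k \<le> fold (bump m) p z k - int n" using j'(2) s_Suc by simp
    qed
    then show "z k + int (length p) \<le> fold (bump m) p z k" using len by simp
  qed (rule sp)
  then show ?thesis by (rule that)
qed

section \<open>Sets closed under adding the modulus\<close>

lemma fold_take_Suc: "r < length p \<Longrightarrow> fold f (take (Suc r) p) x = f (p ! r) (fold f (take r p) x)"
  by (simp add: take_Suc_conv_app_nth)

lemma mod_eq_obtain_nat:
  fixes s t :: int
  assumes "s \<le> t" "s mod int m = t mod int m"
  obtains j :: nat where "t = s + int j * int m"
proof (cases "m = 0")
  case False
  obtain q where q: "t - s = int m * q"
    using assms(2) by (metis dvdE mod_eq_dvd_iff)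
  have "q \<ge> 0"
  proof (rule ccontr)
    assume "\<not> q \<ge> 0"
    then have "int m * q < 0" using False by (intro mult_pos_neg) auto
    then show False using q assms(1) by simp
  qed
  then show ?thesis using that[of "nat q"] q by (simp add: algebra_simps)
qed (use assms that in auto)

lemma sum_of_bool_pos_iff:
  "finite A \<Longrightarrow> (0::int) < (\<Sum>k\<in>A. of_bool (P k)) \<longleftrightarrow> (\<exists>k\<in>A. P k)"
  by (auto simp: sum_of_bool_eq card_gt_0_iff)

lemma residue_system_mono: "residue_system m x \<Longrightarrow> mono_on {..<m} x"
  by (simp add: residue_system_def)

lemma residue_system_inj:
  "\<lbrakk>residue_system m x; x i mod int m = x j mod int m; i < m; j < m\<rbrakk> \<Longrightarrow> i = j"
  by (auto simp: residue_system_def bij_betw_def dest: inj_onD)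

lemma residue_system_ex:
  assumes "residue_system m x" "m > 0"
  obtains k where "k < m" "x k mod int m = t mod int m"
proof -
  have "t mod int m \<in> (\<lambda>k. x k mod int m) ` {..<m}"
    using assms by (simp add: residue_system_def bij_betw_def)
  then show ?thesis using that by auto
qed

lemma residue_system_less_iff:
  assumes x: "residue_system m x" and ij: "i < m" "j < m"
  shows "x i < x j \<longleftrightarrow> i < j"
proof -
  have "x i \<le> x j" if "i \<le> j" "i < m" "j < m" for i j
    using that by (intro mono_onD[OF residue_system_mono[OF x]]) auto
  moreover have "x i \<noteq> x j" if "i \<noteq> j"
    using residue_system_inj[OF x, of i j] ij that by auto
  ultimately show ?thesis using ij by (metis linorder_not_less nat_less_le order_less_le)
qed

lemma residue_system_add:
  assumes "residue_system m x" "m > 0"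
  shows "residue_system m (\<lambda>k. x k + c)"
proof (rule residue_systemI)
  show "mono_on {..<m} (\<lambda>k. x k + c)"
    using residue_system_mono[OF assms(1)] by (simp add: mono_on_def)
  fix t
  obtain k where k: "k < m" "x k mod int m = (t - c) mod int m"
    using residue_system_ex[OF assms] by blast
  have "(x k + c) mod int m = ((t - c) + c) mod int m"
    using k(2) by (rule mod_add_cong) simp
  then show "\<exists>k<m. (x k + c) mod int m = t mod int m" using k(1) by auto
qed (rule assms)

text \<open>For a residue system \<open>x\<close> the entries are the least elements of this set in
  their classes; the value sets \<open>A i\<close> are of this form.\<close>

definition upset :: "nat \<Rightarrow> (nat \<Rightarrow> int) \<Rightarrow> int set" where
  "upset m x = {t. \<exists>k<m. x k \<le> t \<and> x k mod int m = t mod int m}"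

lemma upset_cong: "(\<And>k. k < m \<Longrightarrow> x k = y k) \<Longrightarrow> upset m x = upset m y"
  by (auto simp: upset_def)

lemma upset_add: "t \<in> upset m (\<lambda>k. x k + c) \<longleftrightarrow> t - c \<in> upset m x"
proof -
  have "(x k + c) mod int m = t mod int m \<longleftrightarrow> x k mod int m = (t - c) mod int m" for k
    by (simp add: mod_eq_dvd_iff algebra_simps)
  then show ?thesis by (auto simp: upset_def le_diff_eq)
qed

lemma upset_closed: "t \<in> upset m x \<Longrightarrow> t + int m \<in> upset m x"
  by (force simp: upset_def)

lemma in_upset: "k < m \<Longrightarrow> x k \<in> upset m x"
  by (auto simp: upset_def)

lemma minus_notin_upset:
  assumes x: "residue_system m x" and p: "p < m"
  shows "x p - int m \<notin> upset m x"
proof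
  assume "x p - int m \<in> upset m x"
  then obtain k where k: "k < m" "x k \<le> x p - int m" "x k mod int m = (x p - int m) mod int m"
    by (auto simp: upset_def)
  then have "x k mod int m = x p mod int m" by simp
  then have "k = p" using residue_system_inj[OF x] k(1) p by blast
  then show False using k(2) p by simp
qed

text \<open>Together with \<open>minus_notin_upset\<close> this recognises the generators from the
  set alone.\<close>

lemma minimal_in_upset:
  assumes "v \<in> upset m x" "v - int m \<notin> upset m x"
  obtains k where "k < m" "v = x k"
proof -
  obtain k where k: "k < m" "x k \<le> v" "x k mod int m = v mod int m"
    using assms(1) by (auto simp: upset_def)
  obtain j where j: "v = x k + int j * int m" using mod_eq_obtain_nat[OF k(2,3)] by blast
  have "j = 0"
  proof (rule ccontr)
    assume "j \<noteq> 0"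
    then obtain j' where "j = Suc j'" by (cases j) auto
    then have "v - int m = x k + int j' * int m" using j by (simp add: algebra_simps)
    then have "v - int m \<in> upset m x" using k(1) by (auto simp: upset_def intro!: exI[of _ k])
    then show False using assms(2) by simp
  qed
  then show ?thesis using that k(1) j by simp
qed

text \<open>Each generator below \<open>x p\<close> contributes to the window of length \<open>m\<close> below \<open>x p\<close> its unique
  representative modulo \<open>m\<close>.\<close>

lemma card_upset_window:
  assumes x: "residue_system m x" and p: "p < m"
  shows "card {t \<in> upset m x. x p - int m < t \<and> t < x p} = p"
proof -
  \<comment> \<open>\<open>g k\<close> is the largest number below \<open>x p\<close> congruent to
    \<open>x k\<close>.\<close>
  define g where "g k = x k + int m * ((x p - 1 - x k) div int m)" for k
  have m: "m > 0" using p by simp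
  have g_mod: "g k mod int m = x k mod int m" for k by (simp add: g_def)
  have "bij_betw g {..<p} {t \<in> upset m x. x p - int m < t \<and> t < x p}"
  proof (intro bij_betw_imageI)
    show "inj_on g {..<p}"
    proof (rule inj_onI)
      fix i j assume "i \<in> {..<p}" "j \<in> {..<p}" "g i = g j"
      then show "i = j" using residue_system_inj[OF x, of i j] g_mod[of i] g_mod[of j] p by auto
    qed
    show "g ` {..<p} = {t \<in> upset m x. x p - int m < t \<and> t < x p}"
    proof (intro equalityI subsetI)
      fix t assume "t \<in> g ` {..<p}"
      then obtain k where k: "k < p" "t = g k" by auto
      have gk: "g k = x p - 1 - (x p - 1 - x k) mod int m"
        using minus_mod_eq_mult_div[of "x p - 1 - x k" "int m"] by (simp add: g_def)
      have "x k < x p" using residue_system_less_iff[OF x] k p by simp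
      then have "x k \<le> g k" using m by (simp add: g_def pos_imp_zdiv_nonneg_iff)
      then have "g k \<in> upset m x" using k p g_mod by (auto simp: upset_def intro!: exI[of _ k])
      moreover have "g k < x p" "x p - int m \<le> g k"
        using gk m pos_mod_bound[of "int m" "x p - 1 - x k"] pos_mod_sign[of "int m" "x p - 1 - x k"]
        by linarith+
      moreover have "x p - int m \<noteq> g k"
      proof
        assume "x p - int m = g k"
        then have "x p mod int m = x k mod int m" using g_mod[of k] by (metis minus_mod_self2)
        then show False using residue_system_inj[OF x, of p k] k p by simp
      qed
      ultimately show "t \<in> {t \<in> upset m x. x p - int m < t \<and> t < x p}" using k(2) by auto
    next
      fix t assume t: "t \<in> {t \<in> upset m x. x p - int m < t \<and> t < x p}"
      then obtain k where k: "k < m" "x k \<le> t" "x k mod int m = t mod int m"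
        by (auto simp: upset_def)
      then have "k < p" using residue_system_less_iff[OF x, of k p] t p by auto
      obtain j where j: "t = x k + int j * int m" using mod_eq_obtain_nat[OF k(2,3)] by blast
      have "(x p - 1 - x k) div int m = ((x p - 1 - t) + int j * int m) div int m"
        using j by (simp add: algebra_simps)
      also have "\<dots> = int j + (x p - 1 - t) div int m" using m by simp
      also have "(x p - 1 - t) div int m = 0" using t by (intro div_pos_pos_trivial) auto
      finally have "t = g k" using j by (simp add: g_def)
      then show "t \<in> g ` {..<p}" using \<open>k < p\<close> by simp
    qed
  qed
  then show ?thesis by (metis bij_betw_same_card card_lessThan)
qed

text \<open>The set determines the entries, as its elements \<open>v\<close> with
  \<open>v - int m\<close> outside, and also their indices, through
  \<open>card_upset_window\<close>.\<close>

lemma residue_system_eqI: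
  assumes x: "residue_system m x" and y: "residue_system m y" and eq: "upset m x = upset m y"
    and k: "k < m"
  shows "x k = y k"
proof -
  obtain l where l: "l < m" "x k = y l"
    using minimal_in_upset[of "x k" m y] in_upset[OF k, of x] minus_notin_upset[OF x k] eq by auto
  then have "k = l" using card_upset_window[OF x k] card_upset_window[OF y l(1)] eq by simp
  then show ?thesis using l by simp
qed

lemma residue_system_bump:
  assumes x: "residue_system m x" and p: "p < m"
  shows "residue_system m (bump m p x)"
proof (rule residue_systemI)
  show "m > 0" using p by simp
  show "mono_on {..<m} (bump m p x)" by (intro mono_on_bump residue_system_mono x)
  fix t
  obtain k where "k < m" "x k mod int m = t mod int m"
    using residue_system_ex[OF x, of t] p by auto
  then have "0 < (\<Sum>k<m. of_bool (x k mod int m = t mod int m) :: int)"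
    by (subst sum_of_bool_pos_iff) auto
  also have "\<dots> = (\<Sum>k<m. of_bool (bump m p x k mod int m = t mod int m))"
    using sum_bump[OF residue_system_mono[OF x] p, of "\<lambda>s. of_bool (s mod int m = t mod int m)"]
    by simp
  finally show "\<exists>k<m. bump m p x k mod int m = t mod int m"
    by (subst (asm) sum_of_bool_pos_iff) auto
qed

text \<open>Membership of \<open>t\<close> is positivity of a sum over all entries, so
  \<open>sum_bump\<close> applies wherever the moved entry ends up. Only \<open>x p\<close>
  represents its class, whose least element becomes \<open>x p + int m\<close>.\<close>

lemma upset_bump:
  assumes x: "residue_system m x" and p: "p < m"
  shows "upset m (bump m p x) = upset m x - {x p}"
proof -
  have "t \<in> upset m (bump m p x) \<longleftrightarrow> t \<in> upset m x \<and> t \<noteq> x p" for t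
  proof -
    define h :: "int \<Rightarrow> int" where "h s = of_bool (s \<le> t \<and> s mod int m = t mod int m)" for s
    have pos: "t \<in> upset m y \<longleftrightarrow> 0 < (\<Sum>k<m. h (y k))" for y
      unfolding h_def by (subst sum_of_bool_pos_iff) (auto simp: upset_def)
    have S: "(\<Sum>k<m. h (bump m p x k)) = (\<Sum>k<m. h (x k)) + h (x p + int m) - h (x p)"
      by (rule sum_bump[OF residue_system_mono[OF x] p])
    show ?thesis
    proof (cases "x p mod int m = t mod int m")
      case False
      then show ?thesis using S by (auto simp: pos h_def)
    next
      case True
      have "h (x k) = 0" if "k \<in> {..<m} - {p}" for k
        using residue_system_inj[OF x, of k p] that p True by (auto simp: h_def)
      then have "(\<Sum>k<m. h (x k)) = h (x p)"
        using p by (subst sum.remove[of _ p]) auto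
      moreover have "x p \<le> t \<and> t \<noteq> x p \<longleftrightarrow> x p + int m \<le> t"
      proof
        assume t: "x p \<le> t \<and> t \<noteq> x p"
        then obtain j where "t = x p + int j * int m" using True mod_eq_obtain_nat by blast
        moreover from this have "j > 0" using t by (cases j) auto
        then have "1 * int m \<le> int j * int m" by (intro mult_right_mono) auto
        ultimately show "x p + int m \<le> t" by simp
      qed (use p in auto)
      ultimately show ?thesis using S True by (auto simp: pos h_def)
    qed
  qed
  then show ?thesis by auto
qed

lemma residue_system_fold_bump:
  "\<lbrakk>residue_system m x; set p \<subseteq> {..<m}\<rbrakk> \<Longrightarrow> residue_system m (fold (bump m) p x)"
  by (induction p arbitrary: x) (simp_all add: residue_system_bump)

text \<open>The tuple sorts the elements \<open>g\<close> of \<open>A\<close> with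
  \<open>g - int m\<close> outside \<open>A\<close>. Descent by \<open>m\<close> stops because of
  the lower bound, so each class has such an element; closure makes it unique.\<close>

lemma residue_system_of_upset:
  assumes m: "m > 0" and closed: "\<And>t. t \<in> A \<Longrightarrow> t + int m \<in> A"
    and ex: "\<And>r. \<exists>t\<in>A. t mod int m = r mod int m" and bdd: "\<And>t. t \<in> A \<Longrightarrow> b \<le> t"
  obtains x where "residue_system m x" "upset m x = A"
proof -
  define G where "G = {a \<in> A. a - int m \<notin> A}"
  have up: "t \<in> A" if s: "s \<in> A" and st: "s \<le> t" "s mod int m = t mod int m" for s t
  proof -
    obtain j where j: "t = s + int j * int m" using mod_eq_obtain_nat[OF st] by blast
    have "s + int j * int m \<in> A" for j
    proof (induction j)
      case (Suc j)
      then show ?case using closed[of "s + int j * int m"] by (simp add: algebra_simps)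
    qed (use s in simp)
    then show ?thesis using j by simp
  qed
  have down: "\<exists>g\<in>G. g \<le> a \<and> g mod int m = a mod int m" if "a \<in> A" for a
    using that
  proof (induction "nat (a - b)" arbitrary: a rule: less_induct)
    case less
    show ?case
    proof (cases "a - int m \<in> A")
      case True
      then obtain g where "g \<in> G" "g \<le> a - int m" "g mod int m = (a - int m) mod int m"
        using less(1)[of "a - int m"] bdd[of "a - int m"] m by auto
      then show ?thesis by (intro bexI[of _ g]) auto
    qed (use less(2) in \<open>auto simp: G_def\<close>)
  qed
  have le: "g' \<le> g" if gg: "g \<in> G" "g' \<in> G" "g mod int m = g' mod int m" for g g'
  proof (rule ccontr)
    assume "\<not> g' \<le> g"
    then have "g \<le> g'" by simp
    then obtain j where j: "g' = g + int j * int m"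
      using mod_eq_obtain_nat[OF _ gg(3)] by blast
    moreover have "j > 0" using j \<open>\<not> g' \<le> g\<close> by (cases j) auto
    then have "1 * int m \<le> int j * int m" by (intro mult_right_mono) auto
    ultimately have "g \<le> g' - int m" by simp
    then have "g' - int m \<in> A" using that up[of g "g' - int m"] by (auto simp: G_def)
    then show False using that by (simp add: G_def)
  qed
  have "bij_betw (\<lambda>g. g mod int m) G {0..<int m}"
  proof (intro bij_betw_imageI inj_onI equalityI subsetI)
    fix r assume "r \<in> {0..<int m}"
    then have r: "r = r mod int m" by simp
    obtain a where "a \<in> A" "a mod int m = r mod int m" using ex by blast
    then obtain g where "g \<in> G" "g mod int m = r" using down r by metis
    then show "r \<in> (\<lambda>g. g mod int m) ` G" by blast
  qed (use le m in \<open>auto intro: antisym\<close>)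
  then have fin: "finite G" and card: "card G = m"
    using bij_betw_finite bij_betw_same_card by fastforce+
  define x where "x k = sorted_list_of_set G ! k" for k
  have len: "length (sorted_list_of_set G) = m" by (simp add: card)
  have xG: "x k \<in> G" if "k < m" for k
    using that len fin nth_mem[of k "sorted_list_of_set G"] by (simp add: x_def)
  have Gx: "\<exists>k<m. x k = g" if "g \<in> G" for g
    using that len fin by (metis in_set_conv_nth set_sorted_list_of_set x_def)
  have mx: "mono_on {..<m} x"
    using len by (auto simp: x_def intro!: mono_onI sorted_nth_mono)
  have "residue_system m x"
  proof (rule residue_systemI[OF m mx])
    fix t
    obtain a where "a \<in> A" "a mod int m = t mod int m" using ex by blast
    then obtain g where "g \<in> G" "g mod int m = t mod int m" using down by metis
    then show "\<exists>k<m. x k mod int m = t mod int m" using Gx by blast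
  qed
  moreover have "upset m x = A"
  proof (intro equalityI subsetI)
    fix t assume "t \<in> upset m x"
    then obtain k where "k < m" "x k \<le> t" "x k mod int m = t mod int m" by (auto simp: upset_def)
    then show "t \<in> A" using xG[of k] up[of "x k" t] by (simp add: G_def)
  next
    fix t assume "t \<in> A"
    then obtain g where "g \<in> G" "g \<le> t" "g mod int m = t mod int m" using down by blast
    then show "t \<in> upset m x" using Gx[of g] by (auto simp: upset_def)
  qed
  ultimately show ?thesis by (rule that)
qed

section \<open>From affine permutations to fixed tuples and back\<close>

text \<open>If \<open>w l = w j + int m\<close>, then \<open>l < j\<close> is exactly what the
  hypothesis excludes.\<close>

lemma affine_closed_under_add:
  assumes w: "w \<in> affine_sym_group n" and m: "m > 0"
    and S: "\<And>i j. i < j \<Longrightarrow> w i - w j \<noteq> int m" and t: "t \<in> w ` {i..}"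
  shows "t + int m \<in> w ` {i..}"
proof -
  obtain j where j: "t = w j" "i \<le> j" using t by auto
  have "bij w" using w by (simp add: affine_sym_group_def)
  then obtain l where l: "w l = t + int m" by (metis bij_pointE)
  have "\<not> l < j" using S[of l j] l j by auto
  then show ?thesis using l j by (intro image_eqI[of _ _ l]) auto
qed

text \<open>Injectivity turns the count of positions into a count of values, so the letter depends
  only on \<open>w (r + 1)\<close> and the set of values from there on. Index \<open>r\<close> of
  the list is position \<open>r + 1\<close>.\<close>

lemma nth_B_map:
  assumes w: "inj w" and r: "r < n"
  shows "B_map m n w ! r =
    card {t \<in> w ` {int r + 1..}. w (int r + 1) - int m < t \<and> t < w (int r + 1)}"
proof -
  define J where "J = {j::nat. j > Suc r \<and> w (int j) < w (int (Suc r)) \<and> w (int (Suc r)) - w (int j) < int m}"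
  have "inj_on (\<lambda>j. w (int j)) J" by (auto simp: inj_on_def inj_eq[OF w])
  moreover have "(\<lambda>j. w (int j)) ` J =
    {t \<in> w ` {int r + 1..}. w (int r + 1) - int m < t \<and> t < w (int r + 1)}"
  proof (intro equalityI subsetI)
    fix t assume "t \<in> {t \<in> w ` {int r + 1..}. w (int r + 1) - int m < t \<and> t < w (int r + 1)}"
    then obtain j where j: "t = w j" "int r + 1 \<le> j" "w (int r + 1) - int m < w j" "w j < w (int r + 1)"
      by auto
    then have "j \<noteq> int r + 1" by auto
    then have "nat j \<in> J" using j by (auto simp: J_def add.commute)
    then show "t \<in> (\<lambda>j. w (int j)) ` J" using j by (intro image_eqI[of _ _ "nat j"]) auto
  qed (auto simp: J_def add.commute)
  ultimately have "card {t \<in> w ` {int r + 1..}. w (int r + 1) - int m < t \<and> t < w (int r + 1)} = card J"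
    by (metis card_image)
  moreover have "B_map m n w ! r = card J" using r by (simp add: B_map_def J_def del: upt_Suc)
  ultimately show ?thesis by simp
qed

text \<open>The tuple \<open>fold (bump m) (take r (B w)) x\<close> lists the minimal representatives, in the set of
  values of \<open>w\<close> on \<open>{r + 1..}\<close>, of the residue classes modulo \<open>m\<close>. The letter \<open>B w ! r\<close> is the
  rank of \<open>w (r + 1)\<close> among them.\<close>

lemma B_map_fixes:
  assumes w: "w \<in> affine_sym_group n" and m: "m > 0" and n: "n > 0"
    and S: "\<And>i j. i < j \<Longrightarrow> w i - w j \<noteq> int m"
  obtains x where "fixes_up_to_shift m (B_map m n w) x" "set (B_map m n w) \<subseteq> {..<m}"
    "\<And>r. r < n \<Longrightarrow> w (int r + 1) = fold (bump m) (take r (B_map m n w)) x (B_map m n w ! r)"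
proof -
  let ?I = "{1..int n}"
  define p where "p = B_map m n w"
  have len: "length p = n" by (simp add: p_def B_map_def)
  have bij: "bij w" using w by (simp add: affine_sym_group_def)
  have inj: "inj w" using bij by (rule bij_is_inj)
  have decomp: "\<exists>r\<in>?I. \<exists>q. j = r + q * int n" for j
    using mod_plus_one_in[OF n, of "j - 1"]
    by (intro bexI[of _ "(j - 1) mod int n + 1"] exI[of _ "(j - 1) div int n"]) simp_all
  have wI: "finite (w ` ?I)" "w ` ?I \<noteq> {}" using n by auto
  have low: "Min (w ` ?I) \<le> t" if "t \<in> w ` {1..}" for t
  proof -
    obtain j where j: "t = w j" "1 \<le> j" using \<open>t \<in> w ` {1..}\<close> by auto
    obtain r q where rq: "r \<in> ?I" "j = r + q * int n" using decomp by blast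
    have "q \<ge> 0"
    proof (rule ccontr)
      assume "\<not> q \<ge> 0"
      then have "q * int n \<le> - 1 * int n" by (intro mult_right_mono) auto
      then show False using j rq by auto
    qed
    then have "w r \<le> t" using j rq affine_shift[OF w, of r q] by simp
    moreover have "Min (w ` ?I) \<le> w r" using rq(1) by (intro Min_le wI) auto
    ultimately show ?thesis by simp
  qed
  have high: "t \<in> w ` {1..}" if "Max (w ` ?I) \<le> t" for t
  proof -
    obtain j where j: "t = w j" using bij by (metis bij_pointE)
    obtain r q where rq: "r \<in> ?I" "j = r + q * int n" using decomp by blast
    have "w r \<le> Max (w ` ?I)" using rq(1) by (intro Max_ge wI) auto
    moreover have "t = w r + q * int n" using j rq(2) affine_shift[OF w, of r q] by simp
    ultimately have "0 \<le> q * int n" using that by linarith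
    then have "1 \<le> j" using rq by simp
    then show ?thesis using j by auto
  qed
  obtain x where x: "residue_system m x" "upset m x = w ` {1..}"
  proof (rule residue_system_of_upset[OF m])
    show "t + int m \<in> w ` {1..}" if "t \<in> w ` {1..}" for t
      by (rule affine_closed_under_add[OF w m S that])
    show "\<exists>t\<in>w ` {1..}. t mod int m = r mod int m" for r
    proof
      define q where "q = \<bar>Max (w ` ?I)\<bar> + \<bar>r\<bar>"
      have "q * 1 \<le> q * int m" using m by (intro mult_left_mono) (auto simp: q_def)
      then have "Max (w ` ?I) \<le> r + q * int m" by (simp add: q_def)
      then show "r + q * int m \<in> w ` {1..}" by (rule high)
      show "(r + q * int m) mod int m = r mod int m" by simp
    qed
  qed (use low in auto)
  define X where "X r = fold (bump m) (take r p) x" for r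
  \<comment> \<open>By the hypothesis on differences \<open>w (r + 1)\<close> is least in its class,
    hence an entry; its index and the letter count the same window.\<close>
  have key: "p ! r < m \<and> w (int r + 1) = X r (p ! r)"
    if r: "r < n" and Xr: "residue_system m (X r)" "upset m (X r) = w ` {int r + 1..}" for r
  proof -
    have "w (int r + 1) - int m \<notin> w ` {int r + 1..}"
    proof
      assume "w (int r + 1) - int m \<in> w ` {int r + 1..}"
      then obtain j where j: "w (int r + 1) - int m = w j" "int r + 1 \<le> j" by auto
      moreover from this have "j \<noteq> int r + 1" using m by auto
      ultimately show False using S[of "int r + 1" j] by simp
    qed
    then obtain k where k: "k < m" "w (int r + 1) = X r k"
      using minimal_in_upset[of "w (int r + 1)" m "X r"] Xr(2) by auto
    then have "p ! r = k"
      using card_upset_window[OF Xr(1) k(1)] nth_B_map[OF inj r, of m] Xr(2) by (simp add: p_def)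
    then show ?thesis using k by simp
  qed
  have X: "residue_system m (X r) \<and> upset m (X r) = w ` {int r + 1..}" if "r \<le> n" for r
    using that
  proof (induction r)
    case 0
    then show ?case using x by (simp add: X_def)
  next
    case (Suc r)
    then have IH: "residue_system m (X r)" "upset m (X r) = w ` {int r + 1..}" by simp_all
    note k = key[OF _ IH]
    have "X (Suc r) = bump m (p ! r) (X r)" using Suc.prems len by (simp add: X_def fold_take_Suc)
    moreover have "w ` {int r + 1..} - {w (int r + 1)} = w ` {int (Suc r) + 1..}"
    proof -
      have "{int (Suc r) + 1..} = {int r + 1..} - {int r + 1}" by auto
      then show ?thesis using inj by (simp add: image_set_diff)
    qed
    ultimately show ?case using residue_system_bump[OF IH(1)] upset_bump[OF IH(1)] IH(2) k Suc.prems
      by simp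
  qed
  have pm: "p ! r < m" "w (int r + 1) = X r (p ! r)" if "r < n" for r
    using key[OF that] X[of r] that by simp_all
  have "fold (bump m) p x k = x k + int n" if "k < m" for k
  proof -
    have Xn: "X n = fold (bump m) p x" using len by (simp add: X_def)
    \<comment> \<open>The values on \<open>{n + 1..}\<close> are those on \<open>{1..}\<close>
      translated by \<open>n\<close>, and a set determines its tuple.\<close>
    have "upset m (X n) = upset m (\<lambda>k. x k + int n)"
    proof -
      have "t \<in> w ` {int n + 1..} \<longleftrightarrow> t - int n \<in> w ` {1..}" for t
      proof -
        have "t \<in> w ` {int n + 1..} \<longleftrightarrow> (\<exists>j\<ge>1. t = w (j + 1 * int n))"
        proof
          assume "t \<in> w ` {int n + 1..}"
          then obtain j where "t = w j" "int n + 1 \<le> j" by auto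
          then show "\<exists>j\<ge>1. t = w (j + 1 * int n)" by (intro exI[of _ "j - int n"]) auto
        qed auto
        then show ?thesis unfolding affine_shift[OF w] by force
      qed
      then show ?thesis using X[of n] by (intro set_eqI) (simp add: upset_add x(2))
    qed
    then show ?thesis
      using residue_system_eqI[of m "X n" "\<lambda>k. x k + int n" k] X[of n] residue_system_add[OF x(1) m] that Xn
      by simp
  qed
  then have "fixes_up_to_shift m p x"
    using residue_system_mono[OF x(1)] len by (simp add: fixes_up_to_shift_def)
  moreover have "set p \<subseteq> {..<m}" using pm(1) len by (auto simp: in_set_conv_nth)
  ultimately show ?thesis using that pm(2) by (simp add: p_def X_def)
qed

text \<open>The window represents each class modulo \<open>n\<close> once, so its sum differs from
  \<open>(n + 1) choose 2\<close> by a multiple of \<open>n\<close>, which a constant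
  removes.\<close>

lemma affine_normalize:
  assumes n: "n > 0" and bij: "bij w" and shift: "\<And>a t. w (a + t * int n) = w a + t * int n"
  obtains c where "(\<lambda>i. w i - c) \<in> affine_sym_group n"
proof -
  let ?I = "{1..int n}"
  define r where "r i = (w i - 1) mod int n + 1" for i
  define q where "q i = (w i - 1) div int n" for i
  have w_eq: "w i = r i + q i * int n" for i by (simp add: r_def q_def)
  have "inj_on r ?I"
  proof (rule inj_onI)
    fix i j assume ij: "i \<in> ?I" "j \<in> ?I" "r i = r j"
    have "w i = w j + (q i - q j) * int n" using ij w_eq[of i] w_eq[of j] by (simp add: algebra_simps)
    also have "\<dots> = w (j + (q i - q j) * int n)" by (simp only: shift)
    finally have "i = j + (q i - q j) * int n" using bij by (auto dest: bij_is_inj injD)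
    then have "(i - 1) mod int n = (j - 1) mod int n"
      by (metis add_diff_eq add.commute mod_mult_self1)
    then show "i = j" using ij by simp
  qed
  moreover have "r ` ?I \<subseteq> ?I"
    using mod_plus_one_in[OF n] by (auto simp: r_def simp del: atLeastAtMost_iff)
  ultimately have "bij_betw r ?I ?I" by (simp add: bij_betw_def endo_inj_surj)
  then have "(\<Sum>i\<in>?I. r i) = (\<Sum>i\<in>?I. i)"
    using sum.reindex_bij_betw[of r ?I ?I "\<lambda>i. i"] by simp
  moreover have "(\<Sum>i\<in>?I. w i) = (\<Sum>i\<in>?I. r i) + (\<Sum>i\<in>?I. q i) * int n"
    by (simp add: w_eq sum.distrib sum_distrib_right)
  moreover have "(\<Sum>i\<in>?I. i) = int ((n + 1) choose 2)"
  proof -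
    have "(\<Sum>i\<in>?I. i) = (\<Sum>i\<in>{1..n}. int i)"
      by (rule sum.reindex_bij_witness[of _ int nat]) auto
    also have "\<dots> = int (\<Sum>{1..n})" by simp
    also have "(\<Sum>{1..n}) = (n + 1) choose 2"
      using gauss_sum_from_Suc_0[of n, where 'a = nat] by (simp add: choose_two algebra_simps)
    finally show ?thesis .
  qed
  ultimately have "(\<Sum>i\<in>?I. w i - (\<Sum>i\<in>?I. q i)) = int ((n + 1) choose 2)"
    by (simp add: sum_subtractf)
  moreover have "bij (\<lambda>i. w i - (\<Sum>i\<in>?I. q i))"
    using bij_comp[OF bij bij_diff_right[of "\<Sum>i\<in>?I. q i"]] by (simp add: comp_def)
  moreover have "w (i + int n) = w i + int n" for i using shift[of i 1] by simp
  ultimately show ?thesis using that by (simp add: affine_sym_group_def)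
qed

text \<open>Indices start at \<open>0\<close> here: \<open>Y i\<close> lists the generators before the step with the letter at
  position \<open>i mod n\<close> of the periodic extension of \<open>p\<close> to the integers, and \<open>v i\<close> is the generator
  moved by this step.\<close>

lemma B_map_surj:
  assumes m: "m > 0" and p: "set p \<subseteq> {..<m}" and n: "n > 0" and len: "length p = n"
    and rs: "residue_system m x" and fx: "fixes_up_to_shift m p x"
  obtains w where "w \<in> affine_sym_group n" "\<And>i j. i < j \<Longrightarrow> w i - w j \<noteq> int m" "B_map m n w = p"
proof -
  define a where "a i = p ! nat (i mod int n)" for i
  define Y where "Y i k = fold (bump m) (take (nat (i mod int n)) p) x k + (i div int n) * int n" for i k
  define v where "v i = Y i (a i)" for i
  define U where "U i = upset m (Y i)" for i
  have pos: "nat (i mod int n) < n" for i using n by (simp add: nat_less_iff)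
  have "a i \<in> set p" for i unfolding a_def using pos len by (intro nth_mem) simp
  then have am: "a i < m" for i using p by blast
  have Y: "residue_system m (Y i)" for i
  proof -
    have "set (take k p) \<subseteq> {..<m}" for k using p by (meson order_trans set_take_subset)
    then show ?thesis unfolding Y_def[abs_def]
      by (intro residue_system_add residue_system_fold_bump rs m)
  qed
  have shift: "Y (i + t * int n) k = Y i k + t * int n" for i t k
    using n by (simp add: Y_def algebra_simps)
  have v_shift: "v (i + t * int n) = v i + t * int n" for i t
    using n by (simp add: v_def shift a_def)
  have U_Suc: "U (i + 1) = U i - {v i}" for i
  proof -
    define r where "r = nat (i mod int n)"
    define q where "q = i div int n"
    have i: "i = int r + q * int n" using n by (simp add: r_def q_def)
    have r: "r < n" using pos by (simp add: r_def)
    have "bump m (a i) (Y i) = (\<lambda>k. fold (bump m) (take (Suc r) p) x k + q * int n)"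
      unfolding Y_def[abs_def] bump_add using r len by (simp add: a_def fold_take_Suc flip: r_def q_def)
    moreover have "Y (i + 1) k = fold (bump m) (take (Suc r) p) x k + q * int n" if "k < m" for k
    \<comment> \<open>At the end of a period \<open>Y\<close> restarts from a translate of
      \<open>x\<close>; the shift property of \<open>x\<close> makes this agree with the tuple after
      all \<open>n\<close> letters.\<close>
    proof (cases "Suc r = n")
      case True
      then have "i + 1 = 0 + (q + 1) * int n" using i by (simp add: algebra_simps)
      then have "Y (i + 1) k = Y 0 k + (q + 1) * int n" by (simp only: shift)
      also have "\<dots> = x k + int n + q * int n" by (simp add: Y_def algebra_simps)
      also have "\<dots> = fold (bump m) (take (Suc r) p) x k + q * int n"
        using True fx that len by (simp add: fixes_up_to_shift_def)
      finally show ?thesis .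
    next
      case False
      then have "i + 1 = int (Suc r) + q * int n" using i by simp
      then have "Y (i + 1) k = Y (int (Suc r)) k + q * int n" by (simp only: shift)
      also have "Y (int (Suc r)) k = fold (bump m) (take (Suc r) p) x k"
        using False r by (simp add: Y_def del: of_nat_Suc)
      finally show ?thesis .
    qed
    ultimately have "U (i + 1) = upset m (bump m (a i) (Y i))"
      unfolding U_def by (intro upset_cong) simp
    then show ?thesis using upset_bump[OF Y am] by (simp add: U_def v_def)
  qed
  have U_anti: "U j \<subseteq> U i" if "i \<le> j" for i j
    using that by (induction j rule: int_ge_induct) (auto simp: U_Suc)
  have vU: "v i \<in> U i" for i unfolding U_def v_def by (rule in_upset[OF am])
  have v_notin: "v i \<notin> U j" if "i < j" for i j
    using U_anti[of "i + 1" j] U_Suc[of i] that by auto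
  have inj: "inj v"
  proof (rule linorder_injI)
    fix i j :: int assume "i < j"
    then show "v i \<noteq> v j" using v_notin[of i j] vU[of j] by metis
  qed
  have S: "v i - v j \<noteq> int m" if "i < j" for i j
  proof
    assume "v i - v j = int m"
    then have "v i = v j + int m" by simp
    then have "v i \<in> U j" using upset_closed[of "v j" m "Y j"] vU[of j] by (simp add: U_def)
    then show False using v_notin[OF that] by simp
  qed
  have U0: "t \<in> U (q * int n) \<longleftrightarrow> t - q * int n \<in> upset m x" for t q
  proof -
    have "U (q * int n) = upset m (\<lambda>k. x k + q * int n)"
      unfolding U_def using n by (intro upset_cong) (simp add: Y_def)
    then show ?thesis by (simp add: upset_add)
  qed
  define M where "M = (\<Sum>k<m. \<bar>x k\<bar>)"
  have xM: "\<bar>x k\<bar> \<le> M" if "k < m" for k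
    unfolding M_def using that by (intro member_le_sum) auto
  have "0 \<le> M" by (simp add: M_def sum_nonneg)
  \<comment> \<open>By \<open>hi\<close> every integer is missing from some late set
    \<open>U\<close>, and by \<open>lo\<close> it belongs to some set; so it is removed at some
    step, which makes \<open>v\<close> surjective.\<close>
  have hi: "\<exists>q. t \<notin> U (q * int n) \<and> j \<le> q * int n" for t j
  proof -
    define q where "q = M + \<bar>t\<bar> + \<bar>j\<bar> + 1"
    have "q * 1 \<le> q * int n" using n \<open>0 \<le> M\<close> by (intro mult_left_mono) (auto simp: q_def)
    then have q: "q \<le> q * int n" by simp
    have "t \<notin> U (q * int n)"
    proof
      assume "t \<in> U (q * int n)"
      then obtain k where "k < m" "x k \<le> t - q * int n" by (auto simp: U0 upset_def)
      then show False using xM[of k] q q_def by linarith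
    qed
    moreover have "j \<le> q * int n" using q q_def \<open>0 \<le> M\<close> by linarith
    ultimately show ?thesis by blast
  qed
  have lo: "\<exists>i. t \<in> U i" for t
  proof -
    define q where "q = M + \<bar>t\<bar>"
    have "q * 1 \<le> q * int n" using n \<open>0 \<le> M\<close> by (intro mult_left_mono) (auto simp: q_def)
    then have q: "q \<le> q * int n" by simp
    obtain k where k: "k < m" "x k mod int m = (t - (- q) * int n) mod int m"
      using residue_system_ex[OF rs m] by blast
    moreover have "x k \<le> t - (- q) * int n"
    proof -
      have "x k \<le> t + q * int n" using xM[OF k(1)] q q_def by linarith
      then show ?thesis by simp
    qed
    ultimately have "t \<in> U ((- q) * int n)" unfolding U0 upset_def by blast
    then show ?thesis by blast
  qed
  have U_eq: "U i = v ` {i..}" for i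
  proof (intro equalityI subsetI)
    fix t assume t: "t \<in> U i"
    show "t \<in> v ` {i..}"
    proof (rule ccontr)
      assume A: "t \<notin> v ` {i..}"
      have "t \<in> U j" if "i \<le> j" for j
        using that by (induction j rule: int_ge_induct) (use t A in \<open>auto simp: U_Suc\<close>)
      then show False using hi[of t i] by blast
    qed
  next
    fix t assume "t \<in> v ` {i..}"
    then show "t \<in> U i" using vU U_anti by auto
  qed
  have "surj v" unfolding surj_def using lo U_eq by blast
  define w where "w i = v (i - 1)" for i
  have "bij w"
  proof -
    have "bij (\<lambda>i::int. i - 1)" by (rule bij_diff_right)
    moreover have "bij v" using inj \<open>surj v\<close> by (simp add: bij_def)
    ultimately have "bij (v \<circ> (\<lambda>i. i - 1))" by (rule bij_comp)
    then show ?thesis by (simp add: w_def[abs_def] comp_def)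
  qed
  moreover have "w (i + t * int n) = w i + t * int n" for i t
    using v_shift[of "i - 1" t] by (simp add: w_def algebra_simps)
  ultimately obtain c where c: "(\<lambda>i. w i - c) \<in> affine_sym_group n"
    using affine_normalize[OF n] by blast
  \<comment> \<open>Only differences of values enter \<open>B_map\<close>, so the normalising
    constant is harmless.\<close>
  have "B_map m n (\<lambda>i. w i - c) = B_map m n w" by (simp add: B_map_def)
  also have "\<dots> = p"
  proof (rule nth_equalityI)
    fix r assume "r < length (B_map m n w)"
    then have r: "r < n" by (simp add: B_map_def del: upt_Suc)
    have "w ` {int r + 1..} = U (int r)"
    proof -
      have "(\<lambda>i. i - 1) ` {int r + 1..} = {int r..}"
      proof (intro equalityI subsetI)
        fix i assume "i \<in> {int r..}"
        then show "i \<in> (\<lambda>i. i - 1) ` {int r + 1..}" by (intro image_eqI[of _ _ "i + 1"]) auto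
      qed auto
      then have "v ` (\<lambda>i. i - 1) ` {int r + 1..} = U (int r)" by (simp add: U_eq)
      then show ?thesis by (simp add: w_def[abs_def] image_image)
    qed
    moreover have "w (int r + 1) = Y (int r) (a (int r))" by (simp add: w_def v_def)
    ultimately have "B_map m n w ! r = a (int r)"
      using nth_B_map[OF bij_is_inj[OF \<open>bij w\<close>] r, of m] card_upset_window[OF Y am, of "int r" "int r"]
      by (simp add: U_def)
    then show "B_map m n w ! r = p ! r" using r by (simp add: a_def)
  qed (simp add: B_map_def len)
  finally have "B_map m n (\<lambda>i. w i - c) = p" .
  moreover have "(w i - c) - (w j - c) \<noteq> int m" if "i < j" for i j
    using S[of "i - 1" "j - 1"] that by (simp add: w_def)
  ultimately show ?thesis using that c by blast
qed

theorem theorem6p19: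
  fixes m n :: nat
  assumes "m > 0" and "n > 0" and "coprime m n"
  shows "bij_betw (B_map m n)
           {w \<in> affine_sym_group n. inv w \<in> sommers_perms m n}
           (parking_words m n)"
proof (intro bij_betw_imageI inj_onI equalityI subsetI)
  note m = assms(1) and n = assms(2)
  let ?W = "{w \<in> affine_sym_group n. inv w \<in> sommers_perms m n}"
  have W: "w \<in> ?W \<longleftrightarrow> w \<in> affine_sym_group n \<and> (\<forall>i j. i < j \<longrightarrow> w i - w j \<noteq> int m)" for w
    using inv_in_sommers_perms_iff[OF n m] by auto
  have len: "length (B_map m n w) = n" for w by (simp add: B_map_def)
  have fixed: "\<exists>x. fixes_up_to_shift m (B_map m n w) x \<and> set (B_map m n w) \<subseteq> {..<m} \<and>
    (\<forall>r<n. w (int r + 1) = fold (bump m) (take r (B_map m n w)) x (B_map m n w ! r))"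
    if "w \<in> ?W" for w
  proof -
    have "w \<in> affine_sym_group n" "\<And>i j. i < j \<Longrightarrow> w i - w j \<noteq> int m"
      using that W by blast+
    then show ?thesis by (rule B_map_fixes[OF _ m n]) auto
  qed
  {
    fix w w' assume ww: "w \<in> ?W" "w' \<in> ?W" "B_map m n w = B_map m n w'"
    define p where "p = B_map m n w"
    obtain x where x: "fixes_up_to_shift m p x" and p: "set p \<subseteq> {..<m}"
      and wx: "\<And>r. r < n \<Longrightarrow> w (int r + 1) = fold (bump m) (take r p) x (p ! r)"
      using fixed[OF ww(1), folded p_def] by blast
    obtain x' where x': "fixes_up_to_shift m p x'"
      and wx': "\<And>r. r < n \<Longrightarrow> w' (int r + 1) = fold (bump m) (take r p) x' (p ! r)"
      using fixed[OF ww(2), folded ww(3), folded p_def] by blast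
    obtain c where c: "\<And>k. k < m \<Longrightarrow> x k = x' k + c"
      using fixed_unique[OF m p _ x x'] assms(3) len by (auto simp: p_def)
    \<comment> \<open>The action commutes with translations, so translated tuples give values of
      \<open>w\<close> and \<open>w'\<close> that differ by \<open>c\<close>; equal window sums then
      force \<open>c = 0\<close>.\<close>
    have eq: "w i = w' i + c" if "i \<in> {1..int n}" for i
    proof -
      define r where "r = nat (i - 1)"
      have r: "r < n" "i = int r + 1" using that by (auto simp: r_def)
      have "p ! r \<in> set p" using r len by (intro nth_mem) (simp add: p_def)
      then have "p ! r < m" using p by blast
      moreover have "set (take r p) \<subseteq> {..<m}" using p by (meson order_trans set_take_subset)
      ultimately have "fold (bump m) (take r p) x (p ! r)
          = fold (bump m) (take r p) (\<lambda>k. x' k + c) (p ! r)"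
        using c by (intro fold_bump_cong) auto
      then show ?thesis using wx wx' r by (simp add: fold_bump_add)
    qed
    have "(\<Sum>i\<in>{1..int n}. w i) = (\<Sum>i\<in>{1..int n}. w' i + c)" by (intro sum.cong eq) simp_all
    then have "c = 0" using ww n by (simp add: sum.distrib affine_sym_group_def)
    show "w = w'"
    proof
      fix i
      define r where "r = (i - 1) mod int n + 1"
      have i: "i = r + ((i - 1) div int n) * int n" by (simp add: r_def)
      have "w r = w' r" using eq[of r] \<open>c = 0\<close> mod_plus_one_in[OF n, of "i - 1"] by (simp add: r_def)
      then have "w (r + q * int n) = w' (r + q * int n)" for q
        using ww affine_shift[of w n r q] affine_shift[of w' n r q] by simp
      then show "w i = w' i" using i by metis
    qed
  next
    fix p assume "p \<in> B_map m n ` ?W"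
    then obtain w where w: "w \<in> ?W" "p = B_map m n w" by blast
    then obtain x where "fixes_up_to_shift m p x" "set p \<subseteq> {..<m}"
      using fixed[of w] by blast
    then show "p \<in> parking_words m n" using parking_if_fixed[OF m, of p x] w(2) len by simp
  next
    fix p assume p: "p \<in> parking_words m n"
    then have sp: "set p \<subseteq> {..<m}" "length p = n" using m by (auto simp: parking_words_iff)
    obtain x where x: "fixes_up_to_shift m p x" using fixed_exists[OF p m] by blast
    then have "residue_system m x" using residue_system_if_fixed[OF m sp(1)] sp(2) assms(3) by simp
    then obtain w where "w \<in> affine_sym_group n" "\<And>i j. i < j \<Longrightarrow> w i - w j \<noteq> int m"
      "B_map m n w = p"
      using B_map_surj[OF m sp(1) n sp(2) _ x] by blast
    then show "p \<in> B_map m n ` ?W" using W[of w] by blast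
  }
qed

end
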